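(* Let $\mathcal A$ be a finite-dimensional $C^*$-algebra over $\mathbb F\in\{\mathbb R,\mathbb C\}$. Then the following are equivalent: (i) $\mathcal A$ is abelian. (ii) $\mathcal A=\mathcal L_{\mathcal A}^{\bot\bot}$ and $\mathcal A$ contains no quaternionic blocks in its matrix block decomposition. (iii) $\mathcal A=\mathcal L_{\mathcal A}^{\bot\bot}$ and, for every minimal tuple $A_1,\dots,A_s\in\mathcal A$ with property $\mathcal{FL}$ (that is, a finite tuple of smooth elements such that $\bigcap_{k=1}^sA_k^\bot$ has property $\mathcal{FL}$, with $s$ the least integer for which such a tuple exists), there is no triple of distinct indices $p,q,r\in\{1,\dots,s\}$ for which there exists a non-zero left-symmetric element $X\in\mathcal A$ such that all three sets $$X^\bot\cap\bigcap_{k\ne p}A_k^\bot,\qquad X^\bot\cap\bigcap_{k\ne q}A_k^\bot,\qquad X^\bot\cap\bigcap_{k\ne r}A_k^\bot$$ have property $\mathcal{FL}$.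
   Context: For vectors $v,w$ in a normed space $V$ over $\mathbb F$, $v\perp w$ (Birkhoff–James orthogonality) means $\|v\|\le\|v+\lambda w\|$ for all $\lambda\in\mathbb F$; $v^\bot=\{w: v\perp w\}$, ${}^\bot v=\{w: w\perp v\}$. A vector $v$ is left-symmetric if $v^\bot\subseteq{}^\bot v$. For a subset $\mathcal S\subseteq\mathcal A$, $\mathcal L_{\mathcal S}:=\{v\in\mathcal S: v^\bot\cap\mathcal S\subseteq{}^\bot v\cap\mathcal S\}$; in particular $\mathcal L_{\mathcal A}$ is the set of left-symmetric elements of $\mathcal A$. $\mathcal L_{\mathcal A}^{\bot}:=\bigcap_{v\in\mathcal L_{\mathcal A}}v^\bot$ and $\mathcal L_{\mathcal A}^{\bot\bot}:=\bigcap_{v\in\mathcal L_{\mathcal A}^{\bot}}v^\bot$. A subset $\mathcal S\subseteq\mathcal A$ has property $\mathcal{FL}$ if the set $\{A^\bot: A\in\mathcal L_{\mathcal S}\}$ is finite, where $A^\bot$ is the outgoing neighborhood in $\mathcal A$. An empty intersection $\bigcap_{k}A_k^\bot$ (e.g. when $s=0$) is understood to be $\mathcal A$. $C^*$-algebras may be real or complex. Up to $*$-isomorphism $\mathcal A=\bigoplus_{k=1}^\ell\mathcal M_{n_k}(\mathbb K_k)$ (matrix block decomposition), with all $\mathbb K_k=\mathbb C$ if $\mathbb F=\mathbb C$ and $\mathbb K_k\in\{\mathbb R,\mathbb C,\mathbb H\}$ if $\mathbb F=\mathbb R$; the norm is $\|\bigoplus A_k\|=\max_k\|A_k\|$ with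 operator norms on the blocks. A quaternionic block is one with $\mathbb K_k=\mathbb H$. An element $A=\bigoplus_k A_k$ is smooth if there is exactly one index $i$ with $\|A_i\|=\|A\|$ and, for this $i$, $\dim_{\mathbb K_i}M_0(A_i)=1$, where $M_0(A_i)=\{x\in\mathbb K_i^{n_i}:\|A_ix\|=\|A_i\|\,\|x\|\}$ is regarded as a right $\mathbb K_i$-space. *)

theory Defs
  imports "HOL-Analysis.Analysis"
begin

section \<open>Quaternions\<close>

codatatype quat = Quat (qRe: real) (qIm1: real) (qIm2: real) (qIm3: real)

lemma quat_eqI [intro?]:
  "\<lbrakk>qRe x = qRe y; qIm1 x = qIm1 y; qIm2 x = qIm2 y; qIm3 x = qIm3 y\<rbrakk> \<Longrightarrow> x = y"
  by (rule quat.expand) simp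

lemma quat_eq_iff:
  "x = y \<longleftrightarrow> qRe x = qRe y \<and> qIm1 x = qIm1 y \<and> qIm2 x = qIm2 y \<and> qIm3 x = qIm3 y"
  by (auto intro: quat_eqI)

instantiation quat :: real_algebra_1
begin

primcorec zero_quat where
  "qRe 0 = 0" | "qIm1 0 = 0" | "qIm2 0 = 0" | "qIm3 0 = 0"

primcorec one_quat where
  "qRe 1 = 1" | "qIm1 1 = 0" | "qIm2 1 = 0" | "qIm3 1 = 0"

primcorec plus_quat where
  "qRe (x + y) = qRe x + qRe y"
| "qIm1 (x + y) = qIm1 x + qIm1 y"
| "qIm2 (x + y) = qIm2 x + qIm2 y"
| "qIm3 (x + y) = qIm3 x + qIm3 y"

primcorec uminus_quat where
  "qRe (- x) = - qRe x"
| "qIm1 (- x) = - qIm1 x"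
| "qIm2 (- x) = - qIm2 x"
| "qIm3 (- x) = - qIm3 x"

primcorec minus_quat where
  "qRe (x - y) = qRe x - qRe y"
| "qIm1 (x - y) = qIm1 x - qIm1 y"
| "qIm2 (x - y) = qIm2 x - qIm2 y"
| "qIm3 (x - y) = qIm3 x - qIm3 y"

primcorec times_quat where
  "qRe (x * y) = qRe x * qRe y - qIm1 x * qIm1 y - qIm2 x * qIm2 y - qIm3 x * qIm3 y"
| "qIm1 (x * y) = qRe x * qIm1 y + qIm1 x * qRe y + qIm2 x * qIm3 y - qIm3 x * qIm2 y"
| "qIm2 (x * y) = qRe x * qIm2 y - qIm1 x * qIm3 y + qIm2 x * qRe y + qIm3 x * qIm1 y"
| "qIm3 (x * y) = qRe x * qIm3 y + qIm1 x * qIm2 y - qIm2 x * qIm1 y + qIm3 x * qRe y"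

primcorec scaleR_quat where
  "qRe (scaleR r x) = r * qRe x"
| "qIm1 (scaleR r x) = r * qIm1 x"
| "qIm2 (scaleR r x) = r * qIm2 x"
| "qIm3 (scaleR r x) = r * qIm3 x"

instance
  by standard (simp_all add: quat_eq_iff algebra_simps)

end

instantiation quat :: real_normed_div_algebra
begin

definition norm_quat where
  "norm x = sqrt ((qRe x)\<^sup>2 + (qIm1 x)\<^sup>2 + (qIm2 x)\<^sup>2 + (qIm3 x)\<^sup>2)"

definition sgn_quat where "sgn (x::quat) = x /\<^sub>R norm x"

definition dist_quat where "dist (x::quat) y = norm (x - y)"

definition uniformity_quat where
  "(uniformity :: (quat \<times> quat) filter) = (INF e\<in>{0<..}. principal {(x, y). dist x y < e})"

definition open_quat where
  "open (U :: quat set) \<longleftrightarrow> (\<forall>x\<in>U. eventually (\<lambda>(x', y). x' = x \<longrightarrow> y \<in> U) uniformity)"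

primcorec inverse_quat where
  "qRe (inverse x) = qRe x / ((qRe x)\<^sup>2 + (qIm1 x)\<^sup>2 + (qIm2 x)\<^sup>2 + (qIm3 x)\<^sup>2)"
| "qIm1 (inverse x) = - qIm1 x / ((qRe x)\<^sup>2 + (qIm1 x)\<^sup>2 + (qIm2 x)\<^sup>2 + (qIm3 x)\<^sup>2)"
| "qIm2 (inverse x) = - qIm2 x / ((qRe x)\<^sup>2 + (qIm1 x)\<^sup>2 + (qIm2 x)\<^sup>2 + (qIm3 x)\<^sup>2)"
| "qIm3 (inverse x) = - qIm3 x / ((qRe x)\<^sup>2 + (qIm1 x)\<^sup>2 + (qIm2 x)\<^sup>2 + (qIm3 x)\<^sup>2)"

definition divide_quat where "(x::quat) div y = x * inverse y"

lemma norm_quat_eq_L2_set: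
  "norm x = L2_set (\<lambda>i. [qRe x, qIm1 x, qIm2 x, qIm3 x] ! i) {..<4}"
  by (simp add: norm_quat_def L2_set_def eval_nat_numeral)

instance
proof
  fix x y :: quat and r :: real
  show "sgn x = x /\<^sub>R norm x" "dist x y = norm (x - y)" "x div y = x * inverse y"
    by (simp_all add: sgn_quat_def dist_quat_def divide_quat_def)
  show "(uniformity :: (quat \<times> quat) filter) = (INF e\<in>{0<..}. principal {(x, y). dist x y < e})"
    by (rule uniformity_quat_def)
  show "open U \<longleftrightarrow> (\<forall>x\<in>U. eventually (\<lambda>(x', y). x' = x \<longrightarrow> y \<in> U) uniformity)" for U :: "quat set"
    by (rule open_quat_def)
  show "norm x = 0 \<longleftrightarrow> x = 0"
    by (simp add: norm_quat_def quat_eq_iff add_nonneg_eq_0_iff)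
  have "L2_set (\<lambda>i. [qRe (x+y), qIm1 (x+y), qIm2 (x+y), qIm3 (x+y)] ! i) {..<4}
      = L2_set (\<lambda>i. [qRe x, qIm1 x, qIm2 x, qIm3 x] ! i + [qRe y, qIm1 y, qIm2 y, qIm3 y] ! i) {..<4}"
    by (simp add: L2_set_def eval_nat_numeral)
  then show "norm (x + y) \<le> norm x + norm y"
    unfolding norm_quat_eq_L2_set using L2_set_triangle_ineq by metis
  show "norm (r *\<^sub>R x) = \<bar>r\<bar> * norm x"
    by (simp add: norm_quat_def power_mult_distrib real_sqrt_mult flip: distrib_left)
  show "norm (x * y) = norm x * norm y"
    unfolding norm_quat_def real_sqrt_mult[symmetric]
    by (rule arg_cong[where f = sqrt], simp, algebra)
  show "inverse x * x = 1" "x * inverse x = 1" if "x \<noteq> 0"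
  proof -
    have "(qRe x)\<^sup>2 + (qIm1 x)\<^sup>2 + (qIm2 x)\<^sup>2 + (qIm3 x)\<^sup>2 \<noteq> 0"
      using that by (simp add: quat_eq_iff add_nonneg_eq_0_iff)
    then show "inverse x * x = 1" "x * inverse x = 1"
      by (simp_all add: quat_eq_iff add_divide_distrib[symmetric] diff_divide_distrib[symmetric]
          power2_eq_square[symmetric] mult.commute)
  qed
  show "inverse (0::quat) = 0"
    by (simp add: quat_eq_iff)
qed

end

primcorec qcnj :: "quat \<Rightarrow> quat" where
  "qRe (qcnj x) = qRe x"
| "qIm1 (qcnj x) = - qIm1 x"
| "qIm2 (qcnj x) = - qIm2 x"
| "qIm3 (qcnj x) = - qIm3 x"

definition quat_of_complex :: "complex \<Rightarrow> quat" where
  "quat_of_complex z = Quat (Re z) (Im z) 0 0"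


section \<open>Finite-dimensional C*-algebras over the reals or the complex numbers\<close>

text \<open>
  The algebra is the whole type \<open>'a\<close>, and the field \<open>\<real>\<close> or \<open>\<complex>\<close> is the set \<open>F\<close> of complex
  numbers; \<open>smul z\<close> is meaningful only for \<open>z \<in> F\<close>. Completeness is automatic in finite
  dimension, and the real span is the right one for both fields, since a complex space is
  finite-dimensional iff it is so over the reals. The axiom \<open>quasi_inverse\<close> says that
  \<open>1 + a\<^sup>* a\<close> is invertible in the unitization: it is the additional axiom of real
  C*-algebras (and is automatic for complex ones), stated without presupposing a unit.
\<close>

locale fin_dim_cstar_algebra =
  fixes F :: "complex set"
    and smul :: "complex \<Rightarrow> 'a::real_normed_algebra \<Rightarrow> 'a"
    and star :: "'a \<Rightarrow> 'a"
  assumes field_real_or_complex: "F = \<real> \<or> F = UNIV"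
    and smul_of_real: "smul (of_real r) a = r *\<^sub>R a"
    and smul_add_left: "\<lbrakk>z \<in> F; w \<in> F\<rbrakk> \<Longrightarrow> smul (z + w) a = smul z a + smul w a"
    and smul_add_right: "z \<in> F \<Longrightarrow> smul z (a + b) = smul z a + smul z b"
    and smul_smul: "\<lbrakk>z \<in> F; w \<in> F\<rbrakk> \<Longrightarrow> smul z (smul w a) = smul (z * w) a"
    and smul_mult_left: "z \<in> F \<Longrightarrow> smul z a * b = smul z (a * b)"
    and smul_mult_right: "z \<in> F \<Longrightarrow> a * smul z b = smul z (a * b)"
    and norm_smul: "z \<in> F \<Longrightarrow> norm (smul z a) = norm z * norm a"
    and star_star: "star (star a) = a"
    and star_add: "star (a + b) = star a + star b"
    and star_mult: "star (a * b) = star b * star a"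
    and star_smul: "z \<in> F \<Longrightarrow> star (smul z a) = smul (cnj z) (star a)"
    and cstar_identity: "norm (star a * a) = (norm a)\<^sup>2"
    and quasi_inverse: "\<exists>b. star a * a + b + star a * a * b = 0 \<and> star a * a + b + b * (star a * a) = 0"
    and finite_dimensional: "\<exists>B::'a set. finite B \<and> span B = UNIV"


section \<open>Matrix block algebras\<close>

text \<open>
  All three division rings are viewed inside the quaternions. A vector of length \<open>n\<close> is a
  function on \<open>nat\<close> vanishing from \<open>n\<close> on, and similarly for matrices and for families of blocks.
\<close>

datatype division_ring = Real_Div | Complex_Div | Quaternion_Div

fun div_ring_set :: "division_ring \<Rightarrow> quat set" where
  "div_ring_set Real_Div = \<real>"
| "div_ring_set Complex_Div = range quat_of_complex"
| "div_ring_set Quaternion_Div = UNIV"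

type_synonym block = "nat \<times> division_ring"
type_synonym qvec = "nat \<Rightarrow> quat"
type_synonym qmat = "nat \<Rightarrow> nat \<Rightarrow> quat"

definition vec_carrier :: "block \<Rightarrow> qvec set" where
  "vec_carrier b = {x. (\<forall>i<fst b. x i \<in> div_ring_set (snd b)) \<and> (\<forall>i\<ge>fst b. x i = 0)}"

definition mat_carrier :: "block \<Rightarrow> qmat set" where
  "mat_carrier b = {A. \<forall>i j. if i < fst b \<and> j < fst b then A i j \<in> div_ring_set (snd b) else A i j = 0}"

definition vec_norm :: "block \<Rightarrow> qvec \<Rightarrow> real" where
  "vec_norm b x = L2_set (\<lambda>i. norm (x i)) {..<fst b}"

definition mat_vec :: "block \<Rightarrow> qmat \<Rightarrow> qvec \<Rightarrow> qvec" where
  "mat_vec b A x = (\<lambda>i. \<Sum>j<fst b. A i j * x j)"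

definition mat_mult :: "block \<Rightarrow> qmat \<Rightarrow> qmat \<Rightarrow> qmat" where
  "mat_mult b A B = (\<lambda>i j. \<Sum>m<fst b. A i m * B m j)"

definition mat_norm :: "block \<Rightarrow> qmat \<Rightarrow> real" where
  "mat_norm b A = (SUP x\<in>{x \<in> vec_carrier b. vec_norm b x \<le> 1}. vec_norm b (mat_vec b A x))"

definition block_sum_carrier :: "block list \<Rightarrow> (nat \<Rightarrow> qmat) set" where
  "block_sum_carrier bs =
     {M. (\<forall>k<length bs. M k \<in> mat_carrier (bs ! k)) \<and> (\<forall>k\<ge>length bs. M k = (\<lambda>_ _. 0))}"

text \<open>The inserted 0 only matters for the empty direct sum.\<close>

definition block_sum_norm :: "block list \<Rightarrow> (nat \<Rightarrow> qmat) \<Rightarrow> real" where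
  "block_sum_norm bs M = Max (insert 0 ((\<lambda>k. mat_norm (bs ! k) (M k)) ` {..<length bs}))"

text \<open>
  \<open>\<phi>\<close> is an (isometric) *-isomorphism over \<open>F\<close> of the algebra onto the direct sum of the
  full matrix algebras described by \<open>bs\<close>. For \<open>F = \<complex>\<close> all entries are complex, so
  multiplying them by \<open>z\<close> from the left is the usual scalar multiplication.
\<close>

definition matrix_block_decomposition ::
  "complex set \<Rightarrow> (complex \<Rightarrow> 'a::real_normed_algebra \<Rightarrow> 'a) \<Rightarrow> ('a \<Rightarrow> 'a)
    \<Rightarrow> block list \<Rightarrow> ('a \<Rightarrow> nat \<Rightarrow> qmat) \<Rightarrow> bool" where
  "matrix_block_decomposition F smul star bs \<phi> \<longleftrightarrow>
     (\<forall>b\<in>set bs. fst b \<ge> 1 \<and> (F = UNIV \<longrightarrow> snd b = Complex_Div)) \<and>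
     bij_betw \<phi> UNIV (block_sum_carrier bs) \<and>
     (\<forall>a a'. \<phi> (a + a') = (\<lambda>k i j. \<phi> a k i j + \<phi> a' k i j)) \<and>
     (\<forall>z\<in>F. \<forall>a. \<phi> (smul z a) = (\<lambda>k i j. quat_of_complex z * \<phi> a k i j)) \<and>
     (\<forall>a a'. \<forall>k<length bs. \<phi> (a * a') k = mat_mult (bs ! k) (\<phi> a k) (\<phi> a' k)) \<and>
     (\<forall>a. \<phi> (star a) = (\<lambda>k i j. qcnj (\<phi> a k j i))) \<and>
     (\<forall>a. norm a = block_sum_norm bs (\<phi> a))"

definition has_quaternionic_block :: "block list \<Rightarrow> bool" where
  "has_quaternionic_block bs \<longleftrightarrow> (\<exists>b\<in>set bs. snd b = Quaternion_Div)"


section \<open>Smooth elements\<close>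

definition right_comb :: "qvec set \<Rightarrow> (qvec \<Rightarrow> quat) \<Rightarrow> qvec" where
  "right_comb B c = (\<lambda>i. \<Sum>v\<in>B. v i * c v)"

text \<open>
  Over a noncommutative division ring, \<open>vector_space\<close> does not apply; \<open>has_right_dim K V d\<close>
  says that \<open>V\<close> is a right \<open>K\<close>-space with a basis of \<open>d\<close> elements.
\<close>

definition has_right_dim :: "quat set \<Rightarrow> qvec set \<Rightarrow> nat \<Rightarrow> bool" where
  "has_right_dim K V d \<longleftrightarrow>
     (\<exists>B. finite B \<and> card B = d \<and> B \<subseteq> V \<and>
        (\<forall>c. (\<forall>v\<in>B. c v \<in> K) \<and> right_comb B c = (\<lambda>_. 0) \<longrightarrow> (\<forall>v\<in>B. c v = 0)) \<and>
        V = {right_comb B c |c. \<forall>v\<in>B. c v \<in> K})"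

definition norm_attaining :: "block \<Rightarrow> qmat \<Rightarrow> qvec set" where
  "norm_attaining b A = {x \<in> vec_carrier b. vec_norm b (mat_vec b A x) = mat_norm b A * vec_norm b x}"

text \<open>
  With this definition 0 counts as smooth in a single block of size 1. This does not matter for
  minimal tuples: everything is in the outgoing neighbourhood of 0, so 0 could be dropped.
\<close>

definition smooth :: "block list \<Rightarrow> (nat \<Rightarrow> qmat) \<Rightarrow> bool" where
  "smooth bs M \<longleftrightarrow>
     (\<exists>i<length bs.
        (\<forall>k<length bs. mat_norm (bs ! k) (M k) = block_sum_norm bs M \<longleftrightarrow> k = i) \<and>
        has_right_dim (div_ring_set (snd (bs ! i))) (norm_attaining (bs ! i) (M i)) 1)"


section \<open>Birkhoff--James orthogonality\<close>

definition bj_orth :: "complex set \<Rightarrow> (complex \<Rightarrow> 'a::real_normed_vector \<Rightarrow> 'a) \<Rightarrow> 'a \<Rightarrow> 'a \<Rightarrow> bool" where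
  "bj_orth F smul v w \<longleftrightarrow> (\<forall>z\<in>F. norm v \<le> norm (v + smul z w))"

definition out_nbhd :: "complex set \<Rightarrow> (complex \<Rightarrow> 'a::real_normed_vector \<Rightarrow> 'a) \<Rightarrow> 'a \<Rightarrow> 'a set" where
  "out_nbhd F smul v = {w. bj_orth F smul v w}"

definition in_nbhd :: "complex set \<Rightarrow> (complex \<Rightarrow> 'a::real_normed_vector \<Rightarrow> 'a) \<Rightarrow> 'a \<Rightarrow> 'a set" where
  "in_nbhd F smul v = {w. bj_orth F smul w v}"

definition left_symmetric :: "complex set \<Rightarrow> (complex \<Rightarrow> 'a::real_normed_vector \<Rightarrow> 'a) \<Rightarrow> 'a \<Rightarrow> bool" where
  "left_symmetric F smul v \<longleftrightarrow> out_nbhd F smul v \<subseteq> in_nbhd F smul v"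

definition left_symmetrics ::
  "complex set \<Rightarrow> (complex \<Rightarrow> 'a::real_normed_vector \<Rightarrow> 'a) \<Rightarrow> 'a set \<Rightarrow> 'a set" where
  "left_symmetrics F smul S = {v \<in> S. out_nbhd F smul v \<inter> S \<subseteq> in_nbhd F smul v \<inter> S}"

definition common_out ::
  "complex set \<Rightarrow> (complex \<Rightarrow> 'a::real_normed_vector \<Rightarrow> 'a) \<Rightarrow> 'a set \<Rightarrow> 'a set" where
  "common_out F smul S = (\<Inter>v\<in>S. out_nbhd F smul v)"

definition biorth_left_symmetrics ::
  "complex set \<Rightarrow> (complex \<Rightarrow> 'a::real_normed_vector \<Rightarrow> 'a) \<Rightarrow> 'a set" where
  "biorth_left_symmetrics F smul =
     common_out F smul (common_out F smul (left_symmetrics F smul UNIV))"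

definition property_FL ::
  "complex set \<Rightarrow> (complex \<Rightarrow> 'a::real_normed_vector \<Rightarrow> 'a) \<Rightarrow> 'a set \<Rightarrow> bool" where
  "property_FL F smul S \<longleftrightarrow> finite (out_nbhd F smul ` left_symmetrics F smul S)"

text \<open>
  Tuples \<open>A\<^sub>1, \<dots>, A\<^sub>s\<close> are lists (indices start at 0); their entries need not be distinct.
\<close>

definition FL_tuple ::
  "complex set \<Rightarrow> (complex \<Rightarrow> 'a::real_normed_vector \<Rightarrow> 'a) \<Rightarrow> block list \<Rightarrow> ('a \<Rightarrow> nat \<Rightarrow> qmat)
    \<Rightarrow> 'a list \<Rightarrow> bool" where
  "FL_tuple F smul bs \<phi> As \<longleftrightarrow>
     (\<forall>a\<in>set As. smooth bs (\<phi> a)) \<and>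
     property_FL F smul (\<Inter>k<length As. out_nbhd F smul (As ! k))"

definition minimal_FL_tuple ::
  "complex set \<Rightarrow> (complex \<Rightarrow> 'a::real_normed_vector \<Rightarrow> 'a) \<Rightarrow> block list \<Rightarrow> ('a \<Rightarrow> nat \<Rightarrow> qmat)
    \<Rightarrow> 'a list \<Rightarrow> bool" where
  "minimal_FL_tuple F smul bs \<phi> As \<longleftrightarrow>
     FL_tuple F smul bs \<phi> As \<and> (\<forall>Bs. FL_tuple F smul bs \<phi> Bs \<longrightarrow> length As \<le> length Bs)"

definition out_except ::
  "complex set \<Rightarrow> (complex \<Rightarrow> 'a::real_normed_vector \<Rightarrow> 'a) \<Rightarrow> 'a list \<Rightarrow> 'a \<Rightarrow> nat \<Rightarrow> 'a set" where
  "out_except F smul As X p =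
     out_nbhd F smul X \<inter> (\<Inter>k\<in>{..<length As} - {p}. out_nbhd F smul (As ! k))"

end

theory Submission
  imports Defs
begin

text \<open>
  The norm of a direct sum of blocks is a maximum, and this determines the left-symmetric elements.
  If \<open>X\<close> has a nonzero component outside a block in which its norm is attained, that component is
  in the outgoing but not in the incoming neighbourhood of \<open>X\<close>; so a left-symmetric \<open>X\<close> lives in
  one block (\<open>left_symmetrics_concentrated\<close>). A block of size at least two contains no nonzero
  left-symmetric matrix (\<open>large_block_not_left_symmetric\<close>), whereas a block of size one is a
  Euclidean space of real dimension 1, 2 or 4, in which orthogonality is symmetric. Hence the
  left-symmetric elements are exactly the elements of the single blocks of size one, their common
  outgoing neighbourhood is the sum of the larger blocks, and \<open>\<A> = \<L>\<^sup>\<bottom>\<^sup>\<bottom>\<close> says that every block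
  has size one, because only 0 is orthogonal to itself. Since an algebra is abelian iff all its
  blocks have size one and none is quaternionic, this settles the first equivalence.

  For the second one, all blocks have size one. Over \<open>\<complex>\<close> every such block is a complex line,
  the empty tuple is minimal, and there is no quaternionic block. Over \<open>\<real>\<close>, a smooth element \<open>A\<close> is
  peaked at a single block, and its outgoing neighbourhood imposes one real linear equation on that
  block. An intersection of such neighbourhoods therefore is a direct sum of real subspaces of the
  blocks; it has property \<open>\<F>\<L>\<close> iff each summand is at most a line, because the outgoing
  neighbourhood of an element of a block determines the real line through it (\<open>property_FL_iff\<close>).
  So a tuple with property \<open>\<F>\<L>\<close> needs one equation at each complex block and three at each
  quaternionic one. In a minimal tuple without quaternionic blocks, every entry is the only one at
  its block, so a left-symmetric \<open>X\<close> can replace an entry only if it lives in the block of that entry,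
  and it cannot replace two different ones (\<open>no_exchange_without_quaternions\<close>). At a quaternionic
  block, the sum of the components of three entries of a minimal tuple can replace each of the three
  (\<open>exchange_with_quaternions\<close>).
\<close>

section \<open>The quaternions as a Euclidean space\<close>

instantiation quat :: real_inner
begin

definition inner_quat where
  "inner x y = qRe x * qRe y + qIm1 x * qIm1 y + qIm2 x * qIm2 y + qIm3 x * qIm3 y"

instance
  by standard
    (auto simp: inner_quat_def norm_quat_def quat_eq_iff algebra_simps power2_eq_square
      add_nonneg_eq_0_iff)

end

instantiation quat :: euclidean_space
begin

definition Basis_quat where
  "Basis = {Quat 1 0 0 0, Quat 0 1 0 0, Quat 0 0 1 0, Quat 0 0 0 1}"

instance
proof
  show "inner u v = (if u = v then 1 else 0)" if "u \<in> Basis" "v \<in> Basis" for u v :: quat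
    using that unfolding Basis_quat_def by (elim insertE emptyE; simp add: inner_quat_def quat_eq_iff)
  show "(\<forall>u\<in>Basis. inner x u = 0) \<longleftrightarrow> x = 0" for x :: quat
    by (auto simp: Basis_quat_def inner_quat_def quat_eq_iff [of x 0])
qed (simp_all add: Basis_quat_def)

end

lemma DIM_quat: "DIM(quat) = 4"
  by (simp add: Basis_quat_def quat_eq_iff)

lemma quat_components_of_real [simp]:
  "qRe (of_real r) = r" "qIm1 (of_real r) = 0" "qIm2 (of_real r) = 0" "qIm3 (of_real r) = 0"
  by (simp_all add: of_real_def)

lemma qcnj_mult: "qcnj (x * y) = qcnj y * qcnj x"
  by (simp add: quat_eq_iff algebra_simps)

lemma qcnj_add [simp]: "qcnj (x + y) = qcnj x + qcnj y"
  by (simp add: quat_eq_iff)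

lemma qcnj_0 [simp]: "qcnj 0 = 0" and qcnj_qcnj [simp]: "qcnj (qcnj x) = x"
  by (simp_all add: quat_eq_iff)

lemma qcnj_sum: "qcnj (sum f S) = (\<Sum>i\<in>S. qcnj (f i))"
  by (induction S rule: infinite_finite_induct) simp_all

lemma norm_qcnj [simp]: "norm (qcnj x) = norm x"
  by (simp add: norm_quat_def)

lemma qcnj_eq_0_iff [simp]: "qcnj x = 0 \<longleftrightarrow> x = 0"
  by (metis norm_eq_zero norm_qcnj)

lemma qcnj_times_self: "qcnj x * x = of_real ((norm x)\<^sup>2)"
  by (simp add: quat_eq_iff norm_quat_def) (simp add: algebra_simps power2_eq_square)

lemma inner_eq_qRe: "inner x y = qRe (qcnj x * y)"
  by (simp add: inner_quat_def)

lemma inner_mult_left_qcnj: "inner x (y * z) = inner (qcnj y * x) (z::quat)"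
  by (simp add: inner_eq_qRe qcnj_mult algebra_simps)

lemma qRe_sum: "qRe (sum f S) = (\<Sum>i\<in>S. qRe (f i))"
  by (induction S rule: infinite_finite_induct) simp_all

lemma quat_of_complex_of_real: "quat_of_complex (of_real r) = of_real r"
  by (simp add: quat_of_complex_def quat_eq_iff)

lemma qcnj_quat_of_complex: "qcnj (quat_of_complex z) = quat_of_complex (cnj z)"
  by (simp add: quat_of_complex_def quat_eq_iff)

lemma Reals_quat_iff: "q \<in> \<real> \<longleftrightarrow> qIm1 q = 0 \<and> qIm2 q = 0 \<and> qIm3 q = 0"
proof
  assume "qIm1 q = 0 \<and> qIm2 q = 0 \<and> qIm3 q = 0"
  then have "q = of_real (qRe q)" by (simp add: quat_eq_iff)
  then show "q \<in> \<real>" by (metis Reals_of_real)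
qed (auto elim: Reals_cases)

lemma range_quat_of_complex_iff: "q \<in> range quat_of_complex \<longleftrightarrow> qIm2 q = 0 \<and> qIm3 q = 0"
proof
  assume "qIm2 q = 0 \<and> qIm3 q = 0"
  then have "q = quat_of_complex (Complex (qRe q) (qIm1 q))"
    by (simp add: quat_of_complex_def quat_eq_iff)
  then show "q \<in> range quat_of_complex" by blast
qed (auto simp: quat_of_complex_def)

lemma div_ring_set_closed [simp]:
  assumes "x \<in> div_ring_set K"
  shows "qcnj x \<in> div_ring_set K" "r *\<^sub>R x \<in> div_ring_set K"
    "inverse x \<in> div_ring_set K" "- x \<in> div_ring_set K"
    "y \<in> div_ring_set K \<Longrightarrow> x + y \<in> div_ring_set K"
    "y \<in> div_ring_set K \<Longrightarrow> x - y \<in> div_ring_set K"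
    "y \<in> div_ring_set K \<Longrightarrow> x * y \<in> div_ring_set K"
  using assms by (cases K; simp add: Reals_quat_iff range_quat_of_complex_iff)+

lemma div_ring_set_0 [simp]: "0 \<in> div_ring_set K" and div_ring_set_1 [simp]: "1 \<in> div_ring_set K"
  by (cases K; simp add: Reals_quat_iff range_quat_of_complex_iff)+

lemma div_ring_set_sum:
  "(\<And>i. i \<in> S \<Longrightarrow> f i \<in> div_ring_set K) \<Longrightarrow> sum f S \<in> div_ring_set K"
  by (induction S rule: infinite_finite_induct) simp_all

lemma subspace_div_ring_set: "subspace (div_ring_set K)"
  by (simp add: subspace_def)

lemma div_ring_set_commute:
  assumes "x \<in> div_ring_set K" "y \<in> div_ring_set K" "K \<noteq> Quaternion_Div"
  shows "x * y = y * x"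
  using assms
  by (cases K; simp add: Reals_quat_iff range_quat_of_complex_iff quat_eq_iff)


section \<open>Vectors and matrices over a division ring\<close>

definition vec_inner :: "block \<Rightarrow> qvec \<Rightarrow> qvec \<Rightarrow> quat" where
  "vec_inner b u v = (\<Sum>i<fst b. qcnj (u i) * v i)"

lemma vec_norm_power2: "(vec_norm b x)\<^sup>2 = (\<Sum>i<fst b. (norm (x i))\<^sup>2)"
  by (simp add: vec_norm_def L2_set_def sum_nonneg)

lemma vec_norm_nonneg [simp]: "0 \<le> vec_norm b x"
  by (simp add: vec_norm_def)

lemma vec_norm_add_power2:
  "(vec_norm b (\<lambda>i. u i + v i))\<^sup>2 = (vec_norm b u)\<^sup>2 + (vec_norm b v)\<^sup>2 + 2 * qRe (vec_inner b u v)"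
  unfolding vec_norm_power2 vec_inner_def qRe_sum sum_distrib_left sum.distrib [symmetric]
  by (rule sum.cong) (simp_all add: power2_norm_eq_inner inner_quat_def algebra_simps)

lemma vec_norm_triangle: "vec_norm b (\<lambda>i. u i + v i) \<le> vec_norm b u + vec_norm b v"
proof -
  have "vec_norm b (\<lambda>i. u i + v i) \<le> L2_set (\<lambda>i. norm (u i) + norm (v i)) {..<fst b}"
    unfolding vec_norm_def by (intro L2_set_mono norm_triangle_ineq) simp
  also have "\<dots> \<le> vec_norm b u + vec_norm b v"
    unfolding vec_norm_def by (rule L2_set_triangle_ineq)
  finally show ?thesis .
qed

lemma vec_norm_mult_right: "vec_norm b (\<lambda>i. x i * q) = vec_norm b x * norm q"
  by (simp add: vec_norm_def norm_mult L2_set_left_distrib)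

lemma vec_norm_scaleR: "vec_norm b (\<lambda>i. r *\<^sub>R x i) = \<bar>r\<bar> * vec_norm b x"
  by (simp add: vec_norm_def L2_set_right_distrib)

lemma vec_norm_eq_0: "vec_norm b x = 0 \<longleftrightarrow> (\<forall>i<fst b. x i = 0)"
  by (auto simp: vec_norm_def L2_set_eq_0_iff)

lemma vec_inner_add_right: "vec_inner b u (\<lambda>i. v i + w i) = vec_inner b u v + vec_inner b u w"
  by (simp add: vec_inner_def algebra_simps sum.distrib)

lemma vec_inner_mult_right: "vec_inner b u (\<lambda>i. v i * q) = vec_inner b u v * q"
  by (simp add: vec_inner_def sum_distrib_right mult.assoc)

lemma vec_inner_mult_left: "vec_inner b (\<lambda>i. v i * q) u = qcnj q * vec_inner b v u"
  by (simp add: vec_inner_def sum_distrib_left mult.assoc qcnj_mult)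

lemma vec_inner_self: "vec_inner b u u = of_real ((vec_norm b u)\<^sup>2)"
  by (simp add: vec_inner_def qcnj_times_self vec_norm_power2)

lemma vec_inner_commute: "vec_inner b v u = qcnj (vec_inner b u v)"
  by (simp add: vec_inner_def qcnj_sum qcnj_mult)

lemma vec_norm_decomposition:
  assumes "vec_norm b x = 1"
  defines "u' \<equiv> \<lambda>u i. u i - x i * vec_inner b x u"
  shows "vec_inner b x (u' u) = 0" "(vec_norm b u)\<^sup>2 = (norm (vec_inner b x u))\<^sup>2 + (vec_norm b (u' u))\<^sup>2"
proof -
  have *: "u' u = (\<lambda>i. u i + x i * (- vec_inner b x u))"
    by (simp add: u'_def)
  show 1: "vec_inner b x (u' u) = 0"
    unfolding * vec_inner_add_right vec_inner_mult_right by (simp add: vec_inner_self assms)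
  have "u = (\<lambda>i. x i * vec_inner b x u + u' u i)" by (simp add: u'_def)
  then have "(vec_norm b u)\<^sup>2 = (vec_norm b (\<lambda>i. x i * vec_inner b x u + u' u i))\<^sup>2" by simp
  also have "\<dots> = (norm (vec_inner b x u))\<^sup>2 + (vec_norm b (u' u))\<^sup>2"
    unfolding vec_norm_add_power2 vec_norm_mult_right vec_inner_mult_left 1 by (simp add: assms)
  finally show "(vec_norm b u)\<^sup>2 = (norm (vec_inner b x u))\<^sup>2 + (vec_norm b (u' u))\<^sup>2" .
qed

lemma bessel_two:
  assumes "vec_norm b x = 1" "vec_norm b v = 1" "vec_inner b v x = 0"
  shows "(norm (vec_inner b x u))\<^sup>2 + (norm (vec_inner b v u))\<^sup>2 \<le> (vec_norm b u)\<^sup>2"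
proof -
  define u' where "u' = (\<lambda>i. u i - x i * vec_inner b x u)"
  have *: "u' = (\<lambda>i. u i + x i * (- vec_inner b x u))" by (simp add: u'_def)
  have "vec_inner b v u' = vec_inner b v u"
    unfolding * vec_inner_add_right vec_inner_mult_right by (simp add: assms)
  moreover have "(norm (vec_inner b v u'))\<^sup>2 \<le> (vec_norm b u')\<^sup>2"
    using vec_norm_decomposition(2) [OF assms(2), of u'] by simp
  moreover have "(vec_norm b u)\<^sup>2 = (norm (vec_inner b x u))\<^sup>2 + (vec_norm b u')\<^sup>2"
    using vec_norm_decomposition(2) [OF assms(1), of u] by (simp add: u'_def)
  ultimately show ?thesis by simp
qed

lemma vec_carrier_comb:
  assumes "u \<in> vec_carrier b" "v \<in> vec_carrier b" "p \<in> div_ring_set (snd b)" "q \<in> div_ring_set (snd b)"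
  shows "(\<lambda>i. u i * p + v i * q) \<in> vec_carrier b"
  using assms by (auto simp: vec_carrier_def)

lemma vec_carrier_scaleR: "u \<in> vec_carrier b \<Longrightarrow> (\<lambda>i. r *\<^sub>R u i) \<in> vec_carrier b"
  by (auto simp: vec_carrier_def)

lemma vec_carrier_0: "(\<lambda>_. 0) \<in> vec_carrier b"
  by (simp add: vec_carrier_def)

lemma vec_inner_in_div_ring: "u \<in> vec_carrier b \<Longrightarrow> v \<in> vec_carrier b \<Longrightarrow> vec_inner b u v \<in> div_ring_set (snd b)"
  unfolding vec_inner_def by (rule div_ring_set_sum) (auto simp: vec_carrier_def)

lemma mat_vec_in_carrier:
  assumes "A \<in> mat_carrier b" "x \<in> vec_carrier b" shows "mat_vec b A x \<in> vec_carrier b"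
proof -
  have "mat_vec b A x i \<in> div_ring_set (snd b)" if "i < fst b" for i
    unfolding mat_vec_def using assms that
    by (intro div_ring_set_sum div_ring_set_closed) (auto simp: mat_carrier_def vec_carrier_def)
  moreover have "mat_vec b A x i = 0" if "i \<ge> fst b" for i
    unfolding mat_vec_def using assms that
    by (intro sum.neutral) (auto simp: mat_carrier_def split: if_splits)
  ultimately show ?thesis by (auto simp: vec_carrier_def)
qed

lemma mat_vec_mult_right: "mat_vec b A (\<lambda>i. x i * q) = (\<lambda>i. mat_vec b A x i * q)"
  by (simp add: mat_vec_def sum_distrib_right mult.assoc)

lemma mat_vec_scaleR: "mat_vec b A (\<lambda>i. r *\<^sub>R x i) = (\<lambda>i. r *\<^sub>R mat_vec b A x i)"
  by (simp add: mat_vec_def scaleR_sum_right)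

lemma mat_vec_add: "mat_vec b A (\<lambda>i. x i + y i) = (\<lambda>i. mat_vec b A x i + mat_vec b A y i)"
  by (simp add: mat_vec_def algebra_simps sum.distrib)

lemma mat_vec_add_mat:
  "mat_vec b (\<lambda>i j. A i j + q * B i j) x = (\<lambda>i. mat_vec b A x i + q * mat_vec b B x i)"
  by (simp add: mat_vec_def algebra_simps sum.distrib sum_distrib_left)

lemma mat_vec_scaleR_mat:
  "mat_vec b (\<lambda>i j. r *\<^sub>R A i j) x = (\<lambda>i. r *\<^sub>R mat_vec b A x i)"
  by (simp add: mat_vec_def scaleR_sum_right)

lemma mat_vec_rank_one: "mat_vec b (\<lambda>i j. w i * qcnj (x j)) u = (\<lambda>i. w i * vec_inner b x u)"
  by (simp add: mat_vec_def vec_inner_def sum_distrib_left mult.assoc)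

lemma rank_one_in_carrier:
  "w \<in> vec_carrier b \<Longrightarrow> x \<in> vec_carrier b \<Longrightarrow> (\<lambda>i j. w i * qcnj (x j)) \<in> mat_carrier b"
  by (auto simp: mat_carrier_def vec_carrier_def)

lemma mat_carrier_add:
  "A \<in> mat_carrier b \<Longrightarrow> B \<in> mat_carrier b \<Longrightarrow> (\<lambda>i j. A i j + B i j) \<in> mat_carrier b"
  by (simp add: mat_carrier_def)

lemma mat_carrier_scaleR:
  "A \<in> mat_carrier b \<Longrightarrow> (\<lambda>i j. r *\<^sub>R A i j) \<in> mat_carrier b"
  by (auto simp: mat_carrier_def split: if_splits)

lemma unit_vec:
  assumes "j < fst b"
  defines "e \<equiv> \<lambda>i. if i = j then 1 else (0::quat)"
  shows "e \<in> vec_carrier b" "vec_norm b e = 1" "mat_vec b A e i = A i j"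
proof -
  show "e \<in> vec_carrier b"
    using assms by (auto simp: vec_carrier_def)
  have "(norm (e i))\<^sup>2 = (if i = j then 1 else 0)" for i
    by (simp add: e_def)
  then have "(vec_norm b e)\<^sup>2 = 1"
    using assms(1) by (simp add: vec_norm_power2)
  then show "vec_norm b e = 1"
    by (simp add: power2_eq_1_iff) (metis vec_norm_nonneg neg_0_le_iff_le not_one_le_zero)
  show "mat_vec b A e i = A i j"
    using assms(1) by (simp add: mat_vec_def e_def if_distrib cong: if_cong)
qed

text \<open>
  Vectors are functions on \<open>nat\<close>, so the topology here is that of pointwise convergence: the unit
  ball is a closed part of a product of compact sets.
\<close>

lemma compact_vec_unit_ball: "compact {x \<in> vec_carrier b. vec_norm b x \<le> 1}"
proof -
  define T where "T i = (if i < fst b then div_ring_set (snd b) \<inter> cball 0 1 else {0})" for i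
  have "compact (T i)" for i
    unfolding T_def by (simp add: closed_Int_compact closed_subspace subspace_div_ring_set)
  then have "compactin (product_topology (\<lambda>i. euclidean) UNIV) (PiE UNIV T)"
    by (simp add: compactin_PiE)
  then have "compact (PiE UNIV T)"
    by (simp add: euclidean_product_topology)
  moreover have "closed {x. vec_norm b x \<le> 1}"
    unfolding vec_norm_def L2_set_def
    by (intro closed_Collect_le continuous_intros continuous_on_product_coordinates)
  moreover have "{x \<in> vec_carrier b. vec_norm b x \<le> 1} = PiE UNIV T \<inter> {x. vec_norm b x \<le> 1}"
  proof -
    have "norm (x i) \<le> 1" if "vec_norm b x \<le> 1" "i < fst b" for x i
      using member_le_L2_set [of "{..<fst b}" i "\<lambda>i. norm (x i)"] that by (auto simp: vec_norm_def)
    then show ?thesis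
      by (auto simp: vec_carrier_def T_def PiE_def Pi_def split: if_splits)
  qed
  ultimately show ?thesis by (simp add: compact_Int_closed)
qed

lemma mat_norm_attained:
  assumes "fst b \<ge> 1"
  obtains x where "x \<in> vec_carrier b" "vec_norm b x = 1" "vec_norm b (mat_vec b A x) = mat_norm b A"
    "\<And>u. u \<in> vec_carrier b \<Longrightarrow> vec_norm b (mat_vec b A u) \<le> mat_norm b A * vec_norm b u"
proof -
  let ?B = "{x \<in> vec_carrier b. vec_norm b x \<le> 1}"
  let ?f = "\<lambda>x. vec_norm b (mat_vec b A x)"
  have "continuous_on ?B ?f"
    unfolding vec_norm_def mat_vec_def L2_set_def
    by (intro continuous_intros continuous_on_subset [OF continuous_on_product_coordinates]) auto
  moreover have "?B \<noteq> {}"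
    using vec_carrier_0 [of b] vec_norm_eq_0 [of b "\<lambda>_. 0"] by force
  ultimately obtain x where x: "x \<in> ?B" "\<And>y. y \<in> ?B \<Longrightarrow> ?f y \<le> ?f x"
    using continuous_attains_sup [OF compact_vec_unit_ball] by blast
  have N: "mat_norm b A = ?f x"
    unfolding mat_norm_def using x by (intro cSup_eq_maximum) auto
  have bound: "?f u \<le> mat_norm b A * vec_norm b u" if "u \<in> vec_carrier b" for u
  proof (cases "vec_norm b u = 0")
    case True
    then have "?f u = 0" by (simp add: vec_norm_eq_0 mat_vec_def)
    then show ?thesis using True by simp
  next
    case False
    let ?r = "inverse (vec_norm b u)"
    have "?f (\<lambda>i. ?r *\<^sub>R u i) \<le> ?f x"
      using False that by (intro x) (simp add: vec_carrier_scaleR vec_norm_scaleR)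
    then have "?r * ?f u \<le> mat_norm b A"
      by (simp add: N mat_vec_scaleR vec_norm_scaleR)
    then show ?thesis
      using False vec_norm_nonneg [of b u] by (simp add: field_simps less_le)
  qed
  show ?thesis
  proof (cases "mat_norm b A = 0")
    case True
    let ?e = "\<lambda>i::nat. if i = 0 then 1 else (0::quat)"
    have e: "?e \<in> vec_carrier b" "vec_norm b ?e = 1"
      using unit_vec [of 0 b] assms by auto
    then have "?f ?e = 0" using bound [OF e(1)] True
      by (metis antisym mult_zero_left vec_norm_nonneg)
    then show ?thesis using that [of ?e] e bound True by simp
  next
    case False
    then have "mat_norm b A > 0" using N vec_norm_nonneg [of b] by (metis less_le)
    then have "1 \<le> vec_norm b x"
      using bound [of x] x N by (simp add: mult_le_cancel_left1)
    then show ?thesis using that [of x] x N bound by simp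
  qed
qed

lemma mat_norm_nonneg: "fst b \<ge> 1 \<Longrightarrow> 0 \<le> mat_norm b A"
  by (metis mat_norm_attained vec_norm_nonneg)

lemma vec_norm_mat_vec_le:
  assumes "fst b \<ge> 1" "u \<in> vec_carrier b"
  shows "vec_norm b (mat_vec b A u) \<le> mat_norm b A * vec_norm b u"
  by (metis assms mat_norm_attained)

lemma mat_norm_power2_le:
  assumes "fst b \<ge> 1"
    and "\<And>u. u \<in> vec_carrier b \<Longrightarrow> (vec_norm b (mat_vec b A u))\<^sup>2 \<le> C * (vec_norm b u)\<^sup>2"
  shows "(mat_norm b A)\<^sup>2 \<le> C"
proof -
  obtain x where "x \<in> vec_carrier b" "vec_norm b x = 1" "vec_norm b (mat_vec b A x) = mat_norm b A"
    using mat_norm_attained [OF assms(1), of A] by metis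
  then show ?thesis using assms(2) [of x] by simp
qed

lemma mat_norm_eq_0:
  assumes "fst b \<ge> 1" "A \<in> mat_carrier b"
  shows "mat_norm b A = 0 \<longleftrightarrow> A = (\<lambda>_ _. 0)"
proof
  assume 0: "mat_norm b A = 0"
  have "A i j = 0" if "i < fst b" "j < fst b" for i j
  proof -
    let ?e = "\<lambda>k. if k = j then 1 else (0::quat)"
    have "vec_norm b (mat_vec b A ?e) \<le> 0"
      using vec_norm_mat_vec_le [OF assms(1) unit_vec(1) [OF that(2)], of A] 0 by simp
    then have "mat_vec b A ?e i = 0"
      using vec_norm_nonneg [of b "mat_vec b A ?e"] that(1) by (simp add: vec_norm_eq_0 antisym)
    then show ?thesis by (simp add: unit_vec(3) [OF that(2)])
  qed
  moreover have "A i j = 0" if "\<not> (i < fst b \<and> j < fst b)" for i j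
    using assms(2) that unfolding mat_carrier_def mem_Collect_eq by presburger
  ultimately show "A = (\<lambda>_ _. 0)" by blast
next
  assume A: "A = (\<lambda>_ _. 0)"
  obtain x where "vec_norm b (mat_vec b A x) = mat_norm b A"
    using mat_norm_attained [OF assms(1), of A] by metis
  moreover have "mat_vec b A x = (\<lambda>_. 0)" by (simp add: A mat_vec_def)
  ultimately show "mat_norm b A = 0" using vec_norm_eq_0 [of b "\<lambda>_. 0"] by simp
qed

section \<open>Blocks of size at least two contain no left-symmetric matrix\<close>

lemma vec_norm_orthogonal_comb:
  assumes "vec_inner b u v = 0"
  shows "(vec_norm b (\<lambda>i. u i * p + v i * q))\<^sup>2
    = (vec_norm b u)\<^sup>2 * (norm p)\<^sup>2 + (vec_norm b v)\<^sup>2 * (norm q)\<^sup>2"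
  by (simp add: vec_norm_add_power2 vec_norm_mult_right vec_inner_mult_left vec_inner_mult_right assms
      power_mult_distrib)

text \<open>
  All but the first two coordinates of \<open>v\<close> can be taken to be 0, since a homogeneous linear equation
  in two unknowns has a nonzero solution.
\<close>

lemma orthogonal_unit_vector:
  assumes "fst b \<ge> 2" "x \<in> vec_carrier b"
  obtains v where "v \<in> vec_carrier b" "vec_norm b v = 1" "vec_inner b x v = 0"
proof -
  define p where "p = (if x 0 = 0 then 1 else - inverse (qcnj (x 0)) * qcnj (x 1))"
  define q :: quat where "q = (if x 0 = 0 then 0 else 1)"
  define y where "y = (\<lambda>i::nat. if i = 0 then p else if i = 1 then q else 0)"
  have "x 0 \<in> div_ring_set (snd b)" "x 1 \<in> div_ring_set (snd b)"
    using assms by (auto simp: vec_carrier_def)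
  then have "p \<in> div_ring_set (snd b)" "q \<in> div_ring_set (snd b)"
    by (auto simp: p_def q_def)
  then have y: "y \<in> vec_carrier b"
    using assms(1) by (auto simp: y_def vec_carrier_def)
  have "vec_inner b x y = (\<Sum>i\<in>{0,1}. qcnj (x i) * y i)"
    unfolding vec_inner_def using assms(1) by (intro sum.mono_neutral_right) (auto simp: y_def)
  also have "\<dots> = 0"
    by (simp add: y_def p_def q_def mult.assoc [symmetric])
  finally have xy: "vec_inner b x y = 0" .
  have "y 0 \<noteq> 0 \<or> y 1 \<noteq> 0"
    by (simp add: y_def p_def q_def)
  then have "vec_norm b y \<noteq> 0"
    using assms(1) unfolding vec_norm_eq_0 by (metis One_nat_def less_le_trans pos2 one_less_numeral_iff semiring_norm(76))
  then show thesis
    using that [of "\<lambda>i. inverse (vec_norm b y) *\<^sub>R y i"] y xy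
    by (simp add: vec_carrier_scaleR vec_norm_scaleR vec_inner_def scaleR_sum_right [symmetric])
qed

text \<open>
  Let \<open>x\<close> be a unit vector with \<open>\<parallel>M x\<parallel> = \<parallel>M\<parallel>\<close>, and \<open>w = M x\<close>. Every \<open>Y\<close> for which \<open>Y x\<close> is
  orthogonal to \<open>w\<close> is in the outgoing neighbourhood of \<open>M\<close>, by the Pythagorean theorem at \<open>x\<close>.
  Among these, one has to find a \<open>Y\<close> whose norm decreases when a multiple of \<open>M\<close> is added. The part
  of \<open>M\<close> on the orthogonal complement of \<open>x\<close> will do unless it vanishes; in that case \<open>M = w x\<^sup>*\<close>,
  and the size of the block leaves room for a second direction next to \<open>x\<close> and next to \<open>w\<close>. The
  set \<open>Z\<close> contains the scalars; they have to commute with the entries, since orthogonality to \<open>w\<close>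
  must survive multiplication of \<open>Y\<close> by a scalar from the left.
\<close>

lemma large_block_not_left_symmetric:
  assumes n: "fst b \<ge> 2" and M: "M \<in> mat_carrier b" "M \<noteq> (\<lambda>_ _. 0)"
    and comm: "\<And>z q. z \<in> Z \<Longrightarrow> q \<in> div_ring_set (snd b) \<Longrightarrow> z * q = q * z"
  obtains Y t where "Y \<in> mat_carrier b"
    "\<And>z. z \<in> Z \<Longrightarrow> mat_norm b M \<le> mat_norm b (\<lambda>i j. M i j + z * Y i j)"
    "mat_norm b (\<lambda>i j. Y i j + of_real t * M i j) < mat_norm b Y"
proof -
  have n1: "fst b \<ge> 1" using n by simp
  define N where "N = mat_norm b M"
  have N: "N > 0"
    using mat_norm_eq_0 [OF n1 M(1)] M(2) mat_norm_nonneg [OF n1, of M] by (simp add: N_def)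
  obtain x where x: "x \<in> vec_carrier b" "vec_norm b x = 1" and "vec_norm b (mat_vec b M x) = N"
    using mat_norm_attained [OF n1, of M] by (auto simp: N_def)
  define w where "w = mat_vec b M x"
  have w: "w \<in> vec_carrier b" "vec_norm b w = N"
    using mat_vec_in_carrier M x \<open>vec_norm b (mat_vec b M x) = N\<close> by (auto simp: w_def)
  have orth: "mat_norm b M \<le> mat_norm b (\<lambda>i j. M i j + z * Y i j)"
    if Y: "vec_inner b w (mat_vec b Y x) = 0" and z: "z \<in> Z" for Y z
  proof -
    have "qcnj (w i) * (z * v) = z * (qcnj (w i) * v)" if "i < fst b" for i v
    proof -
      have "qcnj (w i) \<in> div_ring_set (snd b)" using w(1) that by (simp add: vec_carrier_def)
      then show ?thesis using comm [OF z] by (simp add: mult.assoc [symmetric])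
    qed
    then have "vec_inner b w (\<lambda>i. z * mat_vec b Y x i) = z * vec_inner b w (mat_vec b Y x)"
      unfolding vec_inner_def sum_distrib_left by (intro sum.cong) auto
    then have "vec_inner b w (\<lambda>i. z * mat_vec b Y x i) = 0"
      using Y by simp
    then have "N\<^sup>2 \<le> (vec_norm b (mat_vec b (\<lambda>i j. M i j + z * Y i j) x))\<^sup>2"
      unfolding mat_vec_add_mat vec_norm_add_power2 w_def [symmetric] w(2) by simp
    then have "N \<le> vec_norm b (mat_vec b (\<lambda>i j. M i j + z * Y i j) x)"
      by (rule power2_le_imp_le) simp
    also have "\<dots> \<le> mat_norm b (\<lambda>i j. M i j + z * Y i j)"
      using vec_norm_mat_vec_le [OF n1 x(1), of "\<lambda>i j. M i j + z * Y i j"] x(2) by simp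
    finally show ?thesis by (simp add: N_def)
  qed
  define R where "R = (\<lambda>i j. w i * qcnj (x j))"
  define Y0 where "Y0 = (\<lambda>i j. M i j + (-1) *\<^sub>R R i j)"
  have R: "R \<in> mat_carrier b" and Y0: "Y0 \<in> mat_carrier b"
    unfolding R_def Y0_def by (intro mat_carrier_add mat_carrier_scaleR rank_one_in_carrier M x w)+
  show thesis
  proof (cases "Y0 = (\<lambda>_ _. 0)")
    case False
    define m where "m = mat_norm b Y0"
    have m: "m > 0"
      using mat_norm_eq_0 [OF n1 Y0] False mat_norm_nonneg [OF n1, of Y0] by (simp add: m_def)
    have MY: "mat_vec b M u = (\<lambda>i. mat_vec b Y0 u i + w i * vec_inner b x u)" for u
    proof -
      have "mat_vec b Y0 u = (\<lambda>i. mat_vec b M u i + (-1) * mat_vec b R u i)"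
        using mat_vec_add_mat [of b M "-1" R u] by (simp add: Y0_def)
      then show ?thesis by (simp add: R_def mat_vec_rank_one)
    qed
    have "mat_vec b Y0 x = (\<lambda>_. 0)"
      using MY [of x] x(2) by (simp add: vec_inner_self w_def fun_eq_iff)
    then have Yx: "mat_vec b Y0 (\<lambda>i. x i * q) = (\<lambda>_. 0)" for q
      by (simp add: mat_vec_mult_right)
    \<comment> \<open>This \<open>s\<close> minimizes \<open>(1 - s)\<^sup>2 m\<^sup>2 + s\<^sup>2 N\<^sup>2\<close>, which bounds \<open>\<parallel>Y0 - s M\<parallel>\<^sup>2\<close>
      because \<open>Y0\<close> and \<open>M - Y0\<close> live on orthogonal subspaces.\<close>
    define s where "s = m\<^sup>2 / (m\<^sup>2 + N\<^sup>2)"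
    have mN: "m\<^sup>2 + N\<^sup>2 > 0" using m by (simp add: add_pos_nonneg)
    then have s: "0 \<le> s" "s \<le> 1" by (simp_all add: s_def)
    define C where "C = (1 - s)\<^sup>2 * m\<^sup>2 + s\<^sup>2 * N\<^sup>2"
    have s': "1 - s = N\<^sup>2 / (m\<^sup>2 + N\<^sup>2)"
      using m unfolding s_def by (simp add: eq_divide_eq left_diff_distrib)
    have "C = (m\<^sup>2 * N\<^sup>2 * (m\<^sup>2 + N\<^sup>2)) / (m\<^sup>2 + N\<^sup>2)\<^sup>2"
      unfolding C_def s' unfolding s_def power_divide
      by (simp add: add_divide_distrib power2_eq_square algebra_simps)
    also have "\<dots> = m\<^sup>2 * N\<^sup>2 / (m\<^sup>2 + N\<^sup>2)"
      using m by (simp add: power2_eq_square [of "m\<^sup>2 + N\<^sup>2"])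
    also have "\<dots> < m\<^sup>2"
      using m N by (simp add: divide_simps add_pos_pos)
    finally have C: "C < m\<^sup>2" .
    have "(vec_norm b (mat_vec b (\<lambda>i j. Y0 i j + of_real (- s) * M i j) u))\<^sup>2
        \<le> C * (vec_norm b u)\<^sup>2" if u: "u \<in> vec_carrier b" for u
    proof -
      define h where "h = vec_inner b x u"
      define u' where "u' = (\<lambda>i. u i - x i * h)"
      have h: "h \<in> div_ring_set (snd b)" using vec_inner_in_div_ring x u by (simp add: h_def)
      have u': "u' \<in> vec_carrier b"
        using vec_carrier_comb [OF u x(1), of 1 "- h"] h by (simp add: u'_def)
      have uu: "(vec_norm b u)\<^sup>2 = (norm h)\<^sup>2 + (vec_norm b u')\<^sup>2"
        using vec_norm_decomposition(2) [OF x(2), of u] by (simp add: u'_def h_def)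
      have "mat_vec b Y0 u = mat_vec b Y0 u'"
        using mat_vec_add [of b Y0 u' "\<lambda>i. x i * h"] Yx by (simp add: u'_def)
      then have "mat_vec b (\<lambda>i j. Y0 i j + of_real (- s) * M i j) u
          = (\<lambda>i. (1 - s) *\<^sub>R mat_vec b Y0 u' i + (- s) *\<^sub>R (w i * h))"
        unfolding mat_vec_add_mat MY [of u] by (simp add: h_def algebra_simps of_real_def)
      then have "vec_norm b (mat_vec b (\<lambda>i j. Y0 i j + of_real (- s) * M i j) u)
          \<le> vec_norm b (\<lambda>i. (1 - s) *\<^sub>R mat_vec b Y0 u' i) + vec_norm b (\<lambda>i. (- s) *\<^sub>R (w i * h))"
        by (simp only: vec_norm_triangle)
      also have "\<dots> \<le> ((1 - s) * m) * vec_norm b u' + (s * N) * norm h"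
        using vec_norm_mat_vec_le [OF n1 u', of Y0] s unfolding vec_norm_scaleR vec_norm_mult_right w(2)
        by (simp add: m_def mult.assoc mult_left_mono)
      finally have "(vec_norm b (mat_vec b (\<lambda>i j. Y0 i j + of_real (- s) * M i j) u))\<^sup>2
          \<le> (((1 - s) * m) * vec_norm b u' + (s * N) * norm h)\<^sup>2"
        by (intro power_mono) auto
      also have "\<dots> \<le> (((1 - s) * m)\<^sup>2 + (s * N)\<^sup>2) * ((vec_norm b u')\<^sup>2 + (norm h)\<^sup>2)"
      proof -
        have "(p * c + q * d)\<^sup>2 \<le> (p\<^sup>2 + q\<^sup>2) * (c\<^sup>2 + d\<^sup>2)" for p q c d :: real
          using zero_le_power2 [of "p * d - q * c"] by (simp add: power2_eq_square algebra_simps)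
        then show ?thesis .
      qed
      also have "\<dots> = C * (vec_norm b u)\<^sup>2"
        by (simp add: C_def uu power_mult_distrib add.commute)
      finally show ?thesis .
    qed
    then have "(mat_norm b (\<lambda>i j. Y0 i j + of_real (- s) * M i j))\<^sup>2 \<le> C"
      by (rule mat_norm_power2_le [OF n1])
    then have "(mat_norm b (\<lambda>i j. Y0 i j + of_real (- s) * M i j))\<^sup>2 < m\<^sup>2"
      using C by simp
    then have "mat_norm b (\<lambda>i j. Y0 i j + of_real (- s) * M i j) < mat_norm b Y0"
      using m by (simp add: m_def power2_less_imp_less)
    moreover have "vec_inner b w (mat_vec b Y0 x) = 0"
      using Yx [of 1] by (simp add: vec_inner_def)
    ultimately show ?thesis using that [OF Y0] orth by blast
  next
    case True
    then have MR: "M = R" by (simp add: Y0_def fun_eq_iff)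
    obtain v where v: "v \<in> vec_carrier b" "vec_norm b v = 1" and xv: "vec_inner b x v = 0"
      using orthogonal_unit_vector [OF n x(1)] .
    obtain w1 where w1: "w1 \<in> vec_carrier b" "vec_norm b w1 = 1" "vec_inner b w w1 = 0"
      using orthogonal_unit_vector [OF n w(1)] .
    define w' where "w' = (\<lambda>i. w1 i * of_real N)"
    have w': "w' \<in> vec_carrier b" "vec_norm b w' = N" "vec_inner b w w' = 0" "vec_inner b w' w = 0"
      using w1 N vec_carrier_scaleR [OF w1(1), of N] vec_inner_commute [of b w1 w]
      by (simp_all add: w'_def vec_norm_mult_right vec_inner_mult_left vec_inner_mult_right)
        (simp add: of_real_def)
    have vx: "vec_inner b v x = 0" using xv vec_inner_commute [of b v x] by simp
    \<comment> \<open>Up to the factor \<open>N\<close>, in the orthonormal systems along \<open>x, v\<close> and \<open>w, w'\<close>, the matrix \<open>M\<close> has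
      the rows \<open>(1, 0)\<close> and \<open>(0, 0)\<close>, and \<open>Y\<close> has the rows \<open>(0, 4)\<close> and \<open>(5, 3)\<close>. The singular values
      of the latter are \<open>sqrt 40\<close>, attained at \<open>x + v\<close>, and \<open>sqrt 10\<close>; replacing its entry 0 by
      \<open>- 1\<close> makes the norm smaller.\<close>
    define Y where "Y = (\<lambda>i j. (5 *\<^sub>R (w' i * qcnj (x j)) + 3 *\<^sub>R (w' i * qcnj (v j)))
        + 4 *\<^sub>R (w i * qcnj (v j)))"
    have Y: "Y \<in> mat_carrier b"
      unfolding Y_def by (intro mat_carrier_add mat_carrier_scaleR rank_one_in_carrier w w' x v)
    have Yu: "mat_vec b Y u = (\<lambda>i. w' i * (5 *\<^sub>R vec_inner b x u + 3 *\<^sub>R vec_inner b v u) + w i * (4 *\<^sub>R vec_inner b v u))" for u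
      unfolding Y_def
      using mat_vec_add_mat [of b _ 1] mat_vec_scaleR_mat mat_vec_rank_one
      by (simp add: algebra_simps)
    have YMu: "mat_vec b (\<lambda>i j. Y i j + of_real (- 1) * M i j) u
        = (\<lambda>i. w' i * (5 *\<^sub>R vec_inner b x u + 3 *\<^sub>R vec_inner b v u) + w i * (4 *\<^sub>R vec_inner b v u - vec_inner b x u))" for u
      unfolding mat_vec_add_mat Yu MR R_def mat_vec_rank_one by (simp add: algebra_simps)
    have "(vec_norm b (mat_vec b (\<lambda>i j. Y i j + of_real (- 1) * M i j) u))\<^sup>2
        \<le> (37 * N\<^sup>2) * (vec_norm b u)\<^sup>2" for u
    proof -
      define p where "p = vec_inner b x u"
      define q where "q = vec_inner b v u"
      have "(vec_norm b (mat_vec b (\<lambda>i j. Y i j + of_real (- 1) * M i j) u))\<^sup>2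
          = N\<^sup>2 * ((norm (5 *\<^sub>R p + 3 *\<^sub>R q))\<^sup>2 + (norm (4 *\<^sub>R q - p))\<^sup>2)"
        unfolding YMu vec_norm_orthogonal_comb [OF w'(4)] by (simp add: w w' p_def q_def algebra_simps)
      moreover have "(norm (5 *\<^sub>R p + 3 *\<^sub>R q))\<^sup>2 + (norm (4 *\<^sub>R q - p))\<^sup>2
          = 26 * (norm p)\<^sup>2 + 25 * (norm q)\<^sup>2 + 22 * inner p q"
        by (simp add: power2_norm_eq_inner inner_commute algebra_simps)
      moreover have "22 * inner p q = 11 * ((norm p)\<^sup>2 + (norm q)\<^sup>2 - (norm (p - q))\<^sup>2)"
        by (simp add: power2_norm_eq_inner inner_commute algebra_simps)
      moreover have "(norm p)\<^sup>2 + (norm q)\<^sup>2 \<le> (vec_norm b u)\<^sup>2"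
        using bessel_two [OF x(2) v(2) vx] by (simp add: p_def q_def)
      ultimately have "(vec_norm b (mat_vec b (\<lambda>i j. Y i j + of_real (- 1) * M i j) u))\<^sup>2
          \<le> N\<^sup>2 * (37 * (vec_norm b u)\<^sup>2)"
        using zero_le_power2 [of "norm q"] zero_le_power2 [of "norm (p - q)"]
        by (smt (verit) mult_left_mono zero_le_power2)
      then show ?thesis by (simp add: mult_ac)
    qed
    then have "(mat_norm b (\<lambda>i j. Y i j + of_real (- 1) * M i j))\<^sup>2 \<le> 37 * N\<^sup>2"
      by (intro mat_norm_power2_le [OF n1])
    also have "\<dots> < 40 * N\<^sup>2" using N by simp
    also have "\<dots> \<le> (mat_norm b Y)\<^sup>2"
    proof -
      let ?u = "\<lambda>i. x i * 1 + v i * 1"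
      have u: "?u \<in> vec_carrier b" by (intro vec_carrier_comb x v) auto
      have "vec_inner b x ?u = 1" "vec_inner b v ?u = 1"
        using vec_inner_add_right x v xv vx by (simp_all add: vec_inner_self)
      then have "(vec_norm b (mat_vec b Y ?u))\<^sup>2 = 80 * N\<^sup>2"
        unfolding Yu vec_norm_orthogonal_comb [OF w'(4)] 
        by (simp add: w w' scaleR_left_distrib [symmetric])
      moreover have "(vec_norm b (mat_vec b Y ?u))\<^sup>2 \<le> (mat_norm b Y * vec_norm b ?u)\<^sup>2"
        by (intro power_mono vec_norm_mat_vec_le n1 u) simp
      moreover have "(vec_norm b ?u)\<^sup>2 = 2"
        unfolding vec_norm_orthogonal_comb [OF xv] by (simp add: x v)
      ultimately show ?thesis by (simp add: power_mult_distrib)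
    qed
    finally have "mat_norm b (\<lambda>i j. Y i j + of_real (- 1) * M i j) < mat_norm b Y"
      by (rule power2_less_imp_less) (rule mat_norm_nonneg [OF n1])
    moreover have "vec_inner b w (mat_vec b Y x) = 0"
      unfolding Yu vec_inner_add_right vec_inner_mult_right using w' vx by simp
    ultimately show ?thesis using that [OF Y] orth by blast
  qed
qed

section \<open>The maximum norm of a direct sum of blocks\<close>

locale matrix_blocks = fin_dim_cstar_algebra F smul star
  for F and smul :: "complex \<Rightarrow> 'a::real_normed_algebra \<Rightarrow> 'a" and star +
  fixes bs :: "block list" and \<phi> :: "'a \<Rightarrow> nat \<Rightarrow> qmat"
  assumes decomposition: "matrix_block_decomposition F smul star bs \<phi>"
begin

lemma of_real_in_F [simp]: "of_real r \<in> F"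
  using field_real_or_complex by auto

lemma mult_in_F [simp]: "z \<in> F \<Longrightarrow> w \<in> F \<Longrightarrow> z * w \<in> F"
  using field_real_or_complex by auto

lemma smul_scaleR: "z \<in> F \<Longrightarrow> smul (of_real t * z) a = t *\<^sub>R smul z a"
  using smul_smul [of "of_real t" z a] by (simp add: smul_of_real)

lemma smul_0 [simp]: "smul z 0 = 0" if "z \<in> F"
  using smul_add_right [OF that, of 0 0] by simp

lemma fst_block: "k < length bs \<Longrightarrow> 1 \<le> fst (bs ! k)"
  using decomposition unfolding matrix_block_decomposition_def by auto

lemma snd_block_complex: "F = UNIV \<Longrightarrow> k < length bs \<Longrightarrow> snd (bs ! k) = Complex_Div"
  using decomposition unfolding matrix_block_decomposition_def by auto

lemma phi_bij: "bij_betw \<phi> UNIV (block_sum_carrier bs)"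
  and phi_add: "\<phi> (a + b) = (\<lambda>k i j. \<phi> a k i j + \<phi> b k i j)"
  and phi_smul: "z \<in> F \<Longrightarrow> \<phi> (smul z a) = (\<lambda>k i j. quat_of_complex z * \<phi> a k i j)"
  and phi_mult: "k < length bs \<Longrightarrow> \<phi> (a * b) k = mat_mult (bs ! k) (\<phi> a k) (\<phi> b k)"
  and norm_phi: "norm a = block_sum_norm bs (\<phi> a)"
  using decomposition unfolding matrix_block_decomposition_def by blast+

lemma phi_inject: "\<phi> a = \<phi> b \<longleftrightarrow> a = b"
  using phi_bij by (auto simp: bij_betw_def inj_def)

lemma phi_in_carrier: "k < length bs \<Longrightarrow> \<phi> a k \<in> mat_carrier (bs ! k)"
  and phi_beyond: "k \<ge> length bs \<Longrightarrow> \<phi> a k = (\<lambda>_ _. 0)"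
  using phi_bij bij_betwE by (fastforce simp: block_sum_carrier_def)+

lemma phi_zero: "\<phi> 0 = (\<lambda>_ _ _. 0)"
  using phi_add [of 0 0] by (simp add: fun_eq_iff)

definition embed :: "nat \<Rightarrow> qmat \<Rightarrow> 'a" where
  "embed k M = inv \<phi> (\<lambda>j. if j = k then M else (\<lambda>_ _. 0))"

definition part :: "nat \<Rightarrow> 'a \<Rightarrow> 'a" where
  "part k a = embed k (\<phi> a k)"

lemma phi_embed:
  assumes "k < length bs" "M \<in> mat_carrier (bs ! k)"
  shows "\<phi> (embed k M) = (\<lambda>j. if j = k then M else (\<lambda>_ _. 0))"
proof -
  have "(\<lambda>j. if j = k then M else (\<lambda>_ _. 0)) \<in> block_sum_carrier bs"
    using assms by (auto simp: block_sum_carrier_def mat_carrier_def)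
  then show ?thesis
    unfolding embed_def by (rule bij_betw_inv_into_right [OF phi_bij])
qed

lemma phi_part: "k < length bs \<Longrightarrow> \<phi> (part k a) = (\<lambda>j. if j = k then \<phi> a k else (\<lambda>_ _. 0))"
  by (simp add: part_def phi_embed phi_in_carrier)

lemma part_embed: "k < length bs \<Longrightarrow> M \<in> mat_carrier (bs ! k) \<Longrightarrow> part k (embed k M) = embed k M"
  by (simp add: part_def phi_embed)

lemma part_add: "k < length bs \<Longrightarrow> part k (a + b) = part k a + part k b"
  by (simp add: phi_inject [symmetric] phi_part phi_add fun_eq_iff)

lemma part_smul: "k < length bs \<Longrightarrow> z \<in> F \<Longrightarrow> part k (smul z a) = smul z (part k a)"
  by (simp add: phi_inject [symmetric] phi_part phi_smul fun_eq_iff)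

lemma part_scaleR: "k < length bs \<Longrightarrow> part k (r *\<^sub>R a) = r *\<^sub>R part k a"
  using part_smul [OF _ of_real_in_F, of k r a] by (simp only: smul_of_real)

lemma part_minus: "k < length bs \<Longrightarrow> part k (a - b) = part k a - part k b"
  using part_add [of k "a - b" b] by simp

lemma part_zero [simp]: "k < length bs \<Longrightarrow> part k 0 = 0"
  by (simp add: phi_inject [symmetric] phi_part phi_zero fun_eq_iff)

lemma part_part: "k < length bs \<Longrightarrow> j < length bs \<Longrightarrow> part j (part k a) = (if j = k then part k a else 0)"
  by (simp add: phi_inject [symmetric] phi_part phi_zero fun_eq_iff)

lemma part_ext:
  assumes "\<And>k. k < length bs \<Longrightarrow> part k a = part k b" shows "a = b"
proof -
  have "\<phi> a k = \<phi> b k" for k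
  proof (cases "k < length bs")
    case True
    then have "\<phi> (part k a) k = \<phi> (part k b) k" using assms by simp
    then show ?thesis using True by (simp add: phi_part)
  qed (simp add: phi_beyond)
  then show ?thesis by (simp add: phi_inject [symmetric] fun_eq_iff)
qed

lemma norm_embed:
  assumes "k < length bs" "M \<in> mat_carrier (bs ! k)"
  shows "norm (embed k M) = mat_norm (bs ! k) M"
proof -
  have "mat_norm (bs ! j) (\<lambda>_ _. 0) = 0" if "j < length bs" for j
    using mat_norm_eq_0 [OF fst_block [OF that], of "\<lambda>_ _. 0"] by (simp add: mat_carrier_def)
  then have "(\<lambda>j. mat_norm (bs ! j) (\<phi> (embed k M) j)) ` {..<length bs} \<subseteq> {0, mat_norm (bs ! k) M}"
    by (auto simp: phi_embed [OF assms])
  moreover have "mat_norm (bs ! k) M \<in> (\<lambda>j. mat_norm (bs ! j) (\<phi> (embed k M) j)) ` {..<length bs}"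
    using assms by (auto simp: phi_embed [OF assms] image_iff intro!: bexI [of _ k])
  ultimately have "insert 0 ((\<lambda>j. mat_norm (bs ! j) (\<phi> (embed k M) j)) ` {..<length bs}) = {0, mat_norm (bs ! k) M}"
    by blast
  then show ?thesis
    using mat_norm_nonneg [OF fst_block [OF assms(1)], of M] by (simp add: norm_phi block_sum_norm_def)
qed

lemma norm_part: "k < length bs \<Longrightarrow> norm (part k a) = mat_norm (bs ! k) (\<phi> a k)"
  by (simp add: part_def norm_embed phi_in_carrier)

lemma norm_eq_Max_part: "norm a = Max (insert 0 ((\<lambda>k. norm (part k a)) ` {..<length bs}))"
proof -
  have "(\<lambda>k. mat_norm (bs ! k) (\<phi> a k)) ` {..<length bs} = (\<lambda>k. norm (part k a)) ` {..<length bs}"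
    by (rule image_cong) (simp_all add: norm_part)
  then show ?thesis by (simp add: norm_phi [of a] block_sum_norm_def)
qed

lemma norm_part_le: "k < length bs \<Longrightarrow> norm (part k a) \<le> norm a"
  unfolding norm_eq_Max_part [of a] by (rule Max_ge) auto

lemma norm_part_attained:
  assumes "a \<noteq> 0" obtains k where "k < length bs" "norm (part k a) = norm a"
proof -
  have "norm a \<in> insert 0 ((\<lambda>k. norm (part k a)) ` {..<length bs})"
    unfolding norm_eq_Max_part [of a] by (rule Max_in) auto
  then show thesis using assms that by auto
qed

definition peaked_at :: "nat \<Rightarrow> 'a \<Rightarrow> bool" where
  "peaked_at k a \<longleftrightarrow> k < length bs \<and> (\<forall>j<length bs. j \<noteq> k \<longrightarrow> norm (part j a) < norm (part k a))"

lemma peaked_at_norm: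
  assumes "peaked_at k a" shows "norm (part k a) = norm a"
proof (cases "a = 0")
  case False
  then obtain j where "j < length bs" "norm (part j a) = norm a" by (rule norm_part_attained)
  moreover have "norm (part k a) \<le> norm a"
    using assms norm_part_le unfolding peaked_at_def by blast
  ultimately show ?thesis
    using assms unfolding peaked_at_def by (metis not_le)
qed (use assms in \<open>simp add: peaked_at_def\<close>)

lemma part_eq_0:
  assumes "k < length bs" "part k a = a" "j < length bs" "j \<noteq> k" shows "part j a = 0"
  using part_part [OF assms(1,3), of a] assms(2,4) by simp

lemma peaked_at_part:
  assumes "k < length bs" "part k a = a" "a \<noteq> 0" shows "peaked_at k a"
  using assms by (simp add: peaked_at_def part_eq_0)

lemma bj_orth_if_bj_orth_part:
  assumes "k < length bs" "norm (part k a) = norm a" "bj_orth F smul (part k a) (part k w)"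
  shows "bj_orth F smul a w"
  unfolding bj_orth_def
proof
  fix z assume z: "z \<in> F"
  have "norm a \<le> norm (part k a + smul z (part k w))"
    using assms z by (simp add: bj_orth_def)
  also have "\<dots> \<le> norm (a + smul z w)"
    using norm_part_le [OF assms(1), of "a + smul z w"] assms(1) z by (simp add: part_add part_smul)
  finally show "norm a \<le> norm (a + smul z w)" .
qed

lemma bj_orth_zero_right [simp]: "bj_orth F smul a 0"
  by (simp add: bj_orth_def)

lemma bj_orth_zero_left [simp]: "bj_orth F smul 0 a"
  by (simp add: bj_orth_def)

text \<open>
  Near \<open>a\<close> the norm only sees the block \<open>k\<close>, and by convexity a norm that decreases along a ray
  already decreases near its starting point.
\<close>

lemma bj_orth_peaked:
  assumes "peaked_at k a"
  shows "bj_orth F smul a w \<longleftrightarrow> bj_orth F smul (part k a) (part k w)"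
proof
  have k: "k < length bs" using assms by (simp add: peaked_at_def)
  assume aw: "bj_orth F smul a w"
  show "bj_orth F smul (part k a) (part k w)"
  proof (rule ccontr)
    assume "\<not> ?thesis"
    then obtain z where z: "z \<in> F" "norm (part k a + smul z (part k w)) < norm (part k a)"
      by (auto simp: bj_orth_def not_le)
    have lim: "((\<lambda>t. norm (x + t *\<^sub>R y)) \<longlongrightarrow> norm x) (at_right 0)" for x y :: 'a
      by (rule tendsto_eq_intros refl | simp)+
    have "\<forall>\<^sub>F t in at_right 0. \<forall>j\<in>{..<length bs} - {k}.
        norm (part j a + t *\<^sub>R smul z (part j w)) < norm (part k a)"
      using assms by (intro eventually_ball_finite ballI order_tendstoD(2) [OF lim])
        (auto simp: peaked_at_def)
    moreover have "\<forall>\<^sub>F t::real in at_right 0. 0 < t \<and> t < 1"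
      by (auto simp: eventually_at_right_field intro: exI [of _ 1])
    ultimately have "\<forall>\<^sub>F t in at_right 0. (\<forall>j\<in>{..<length bs} - {k}.
        norm (part j a + t *\<^sub>R smul z (part j w)) < norm (part k a)) \<and> 0 < t \<and> t < 1"
      by (rule eventually_conj)
    then have "\<exists>t. (\<forall>j\<in>{..<length bs} - {k}.
        norm (part j a + t *\<^sub>R smul z (part j w)) < norm (part k a)) \<and> 0 < t \<and> t < 1"
      by (rule eventually_happens'[rotated]) simp
    then obtain t :: real where t: "0 < t" "t < 1"
      and far: "\<And>j. j < length bs \<Longrightarrow> j \<noteq> k \<Longrightarrow> norm (part j a + t *\<^sub>R smul z (part j w)) < norm (part k a)"
      by blast
    let ?c = "a + smul (of_real t * z) w"
    have part_c: "part j ?c = part j a + t *\<^sub>R smul z (part j w)" if "j < length bs" for j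
    proof -
      have "part j (smul (of_real t * z) w) = smul (of_real t * z) (part j w)"
        using part_smul that z by simp
      then show ?thesis by (simp only: part_add [OF that] smul_scaleR [OF z(1)])
    qed
    have "norm (part k ?c) < norm (part k a)"
    proof -
      have "part k ?c = (1 - t) *\<^sub>R part k a + t *\<^sub>R (part k a + smul z (part k w))"
        unfolding part_c [OF k] by (simp add: algebra_simps)
      then have "norm (part k ?c) \<le> (1 - t) * norm (part k a) + t * norm (part k a + smul z (part k w))"
        using t norm_triangle_ineq [of "(1 - t) *\<^sub>R part k a" "t *\<^sub>R (part k a + smul z (part k w))"] by simp
      also have "\<dots> < (1 - t) * norm (part k a) + t * norm (part k a)"
        using t z by simp
      finally show ?thesis by (simp add: algebra_simps)
    qed
    then have "norm (part j ?c) < norm a" if "j < length bs" for j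
      using far [OF that] part_c [OF that] peaked_at_norm [OF assms] by (cases "j = k") auto
    moreover have "norm a \<le> norm ?c"
      using aw z by (simp add: bj_orth_def)
    moreover have "0 < norm a"
      using z peaked_at_norm [OF assms] by (metis norm_ge_zero not_le order_le_less_trans)
    ultimately show False
      using norm_part_attained [of ?c] by (metis norm_zero not_le)
  qed
qed (use assms peaked_at_norm [OF assms] in \<open>auto simp: peaked_at_def intro: bj_orth_if_bj_orth_part\<close>)

lemma bj_orth_self:
  assumes "bj_orth F smul a a" shows "a = 0"
proof -
  have "norm a \<le> norm (a + smul (of_real (- 1)) a)"
    using assms of_real_in_F unfolding bj_orth_def by blast
  then show ?thesis unfolding smul_of_real by simp
qed

lemma bj_orth_part_self:
  assumes "k < length bs" "bj_orth F smul (part k a) a" shows "part k a = 0"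
proof (rule ccontr)
  assume *: "part k a \<noteq> 0"
  have "bj_orth F smul (part k a) (part k a)"
    using bj_orth_peaked [OF peaked_at_part [OF assms(1) _ *]] assms by (simp add: part_part)
  then show False using bj_orth_self * by blast
qed

text \<open>
  A nonzero component of \<open>X\<close> outside a block in which the norm of \<open>X\<close> is attained can be cut out:
  adding multiples of it does not affect that block, so \<open>X\<close> is orthogonal to it, but it is not
  orthogonal to \<open>X\<close>, which agrees with it where it is supported.
\<close>

lemma left_symmetrics_concentrated:
  assumes closed: "\<And>w k. w \<in> S \<Longrightarrow> k < length bs \<Longrightarrow> part k w \<in> S"
    and X: "X \<in> left_symmetrics F smul S" "X \<noteq> 0"
  obtains k where "k < length bs" "part k X = X"
proof -
  obtain k where k: "k < length bs" "norm (part k X) = norm X"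
    using norm_part_attained X(2) by blast
  have "part j X = 0" if j: "j < length bs" "j \<noteq> k" for j
  proof -
    have "bj_orth F smul X (part j X)"
      by (rule bj_orth_if_bj_orth_part [OF k]) (use j k in \<open>simp add: part_part\<close>)
    then have "bj_orth F smul (part j X) X"
      using X(1) closed j by (auto simp: left_symmetrics_def out_nbhd_def in_nbhd_def)
    then show ?thesis using bj_orth_part_self j by blast
  qed
  then have "part k X = X"
    using k by (intro part_ext [of "part k X"]) (simp add: part_part)
  then show thesis using that k by blast
qed

lemma left_symmetrics_UNIV: "X \<in> left_symmetrics F smul UNIV \<longleftrightarrow> left_symmetric F smul X"
  by (simp add: left_symmetrics_def left_symmetric_def)

lemma quat_of_complex_commute:
  assumes "z \<in> F" "k < length bs" "q \<in> div_ring_set (snd (bs ! k))"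
  shows "quat_of_complex z * q = q * quat_of_complex z"
proof (cases "F = UNIV")
  case True
  then show ?thesis
    using div_ring_set_commute [of _ Complex_Div q] snd_block_complex assms by simp
next
  case False
  then obtain r where "z = of_real r" using field_real_or_complex assms(1) by (auto elim: Reals_cases)
  then have "quat_of_complex z = of_real r" by (simp add: quat_of_complex_of_real)
  then show ?thesis by (simp add: of_real_def)
qed

lemma norm_eq_mat_norm:
  assumes "k < length bs" "part k a = a" shows "norm a = mat_norm (bs ! k) (\<phi> a k)"
  using norm_part [OF assms(1), of a] assms(2) by simp

lemma left_symmetric_part_large_block:
  assumes k: "k < length bs" "fst (bs ! k) \<ge> 2" and X: "left_symmetric F smul X"
  shows "part k X = 0"
proof (rule ccontr)
  assume nz: "part k X \<noteq> 0"
  then have "X \<noteq> 0" using k by auto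
  then obtain i where i: "i < length bs" "part i X = X"
    using left_symmetrics_concentrated [of UNIV X] X left_symmetrics_UNIV by blast
  then have XX: "part k X = X"
    using nz part_eq_0 [OF i k(1)] by metis
  have "\<phi> X k \<noteq> (\<lambda>_ _. 0)"
    using nz norm_part [OF k(1), of X] mat_norm_eq_0 [OF fst_block [OF k(1)] phi_in_carrier [OF k(1)], of X]
    by (metis norm_eq_zero)
  then obtain Y t where Y: "Y \<in> mat_carrier (bs ! k)"
    and out: "\<And>q. q \<in> quat_of_complex ` F \<Longrightarrow> mat_norm (bs ! k) (\<phi> X k) \<le> mat_norm (bs ! k) (\<lambda>i j. \<phi> X k i j + q * Y i j)"
    and not_in: "mat_norm (bs ! k) (\<lambda>i j. Y i j + of_real t * \<phi> X k i j) < mat_norm (bs ! k) Y"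
    using large_block_not_left_symmetric [OF k(2) phi_in_carrier [OF k(1)], of X "quat_of_complex ` F"]
      quat_of_complex_commute k(1) by blast
  let ?y = "embed k Y"
  have y: "part k ?y = ?y" "\<phi> ?y k = Y"
    using k Y by (simp_all add: part_embed phi_embed)
  have "bj_orth F smul X ?y"
    unfolding bj_orth_def
  proof
    fix z assume z: "z \<in> F"
    have "part k (X + smul z ?y) = X + smul z ?y"
      using k z XX y by (simp add: part_add part_smul)
    then show "norm X \<le> norm (X + smul z ?y)"
      using out [of "quat_of_complex z"] z y k XX by (simp add: norm_eq_mat_norm phi_add phi_smul)
  qed
  then have "bj_orth F smul ?y X"
    using X by (auto simp: left_symmetric_def out_nbhd_def in_nbhd_def)
  then have "norm ?y \<le> norm (?y + smul (of_real t) X)"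
    by (simp add: bj_orth_def)
  moreover have "part k (?y + smul (of_real t) X) = ?y + smul (of_real t) X"
    using k XX y by (simp add: part_add part_smul)
  ultimately show False
    using not_in y k XX by (simp add: norm_eq_mat_norm phi_add phi_smul quat_of_complex_of_real)
qed

lemma exists_nonzero_part:
  assumes "k < length bs" obtains y where "part k y = y" "y \<noteq> 0"
proof -
  let ?E = "\<lambda>i j. if i = 0 \<and> j = 0 then 1 else (0::quat)"
  have E: "?E \<in> mat_carrier (bs ! k)"
    using fst_block [OF assms] by (auto simp: mat_carrier_def)
  have "\<phi> (embed k ?E) k 0 0 = 1"
    using phi_embed [OF assms E] by simp
  then have "embed k ?E \<noteq> 0"
    using phi_zero by (metis zero_neq_one)
  then show thesis
    using that part_embed [OF assms E] by blast
qed

text \<open>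
  All elements of a larger block are in the outgoing neighbourhood of every left-symmetric element,
  so the hypothesis would make them orthogonal to themselves.
\<close>

lemma biorth_left_symmetrics_imp_size_one:
  assumes "UNIV = biorth_left_symmetrics F smul" "k < length bs"
  shows "fst (bs ! k) = 1"
proof (rule ccontr)
  assume "fst (bs ! k) \<noteq> 1"
  then have large: "fst (bs ! k) \<ge> 2" using fst_block [OF assms(2)] by simp
  obtain y where y: "part k y = y" "y \<noteq> 0" using exists_nonzero_part assms(2) .
  have "bj_orth F smul X y" if X: "left_symmetric F smul X" for X
  proof (cases "X = 0")
    case False
    then obtain i where i: "i < length bs" "norm (part i X) = norm X"
      using norm_part_attained by blast
    moreover have "i \<noteq> k"
      using left_symmetric_part_large_block [OF assms(2) large X] i False by auto
    ultimately show ?thesis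
      using part_eq_0 [OF assms(2) y(1) i(1)] by (intro bj_orth_if_bj_orth_part [OF i]) simp
  qed simp
  then have "y \<in> common_out F smul (left_symmetrics F smul UNIV)"
    by (auto simp: common_out_def out_nbhd_def left_symmetrics_UNIV)
  moreover have "y \<in> biorth_left_symmetrics F smul" using assms(1) by auto
  ultimately have "bj_orth F smul y y"
    by (auto simp: biorth_left_symmetrics_def common_out_def out_nbhd_def)
  then show False using bj_orth_self y(2) by blast
qed

lemma abelian_iff:
  "(\<forall>a b::'a. a * b = b * a) \<longleftrightarrow> (\<forall>k<length bs. fst (bs ! k) = 1 \<and> snd (bs ! k) \<noteq> Quaternion_Div)"
proof safe
  assume comm: "\<forall>a b::'a. a * b = b * a"
  fix k assume k: "k < length bs"
  have mat_comm: "mat_mult (bs ! k) A B = mat_mult (bs ! k) B A"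
    if "A \<in> mat_carrier (bs ! k)" "B \<in> mat_carrier (bs ! k)" for A B
  proof -
    have "\<phi> (embed k A * embed k B) k = \<phi> (embed k B * embed k A) k" using comm by metis
    then show ?thesis using k that by (simp add: phi_mult phi_embed)
  qed
  define U where "U = (\<lambda>(a::nat) (b::nat) q i j. if i = a \<and> j = b then q else (0::quat))"
  have U: "U a b q \<in> mat_carrier (bs ! k)"
    if "a < fst (bs ! k)" "b < fst (bs ! k)" "q \<in> div_ring_set (snd (bs ! k))" for a b q
    using that by (auto simp: U_def mat_carrier_def)
  have mult_U: "mat_mult (bs ! k) (U 0 0 p) (U 0 b q) 0 b = p * q" for p q b
  proof -
    have "mat_mult (bs ! k) (U 0 0 p) (U 0 b q) 0 b = (\<Sum>m<fst (bs ! k). if m = 0 then p * q else 0)"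
      unfolding mat_mult_def U_def by (intro sum.cong) auto
    then show ?thesis using fst_block [OF k] by simp
  qed
  show "fst (bs ! k) = 1"
  proof (rule ccontr)
    assume "fst (bs ! k) \<noteq> 1"
    then have "mat_mult (bs ! k) (U 0 0 1) (U 0 1 1) = mat_mult (bs ! k) (U 0 1 1) (U 0 0 1)"
      using fst_block [OF k] by (intro mat_comm U) auto
    moreover have "mat_mult (bs ! k) (U 0 1 1) (U 0 0 1) 0 1 = 0"
      by (simp add: mat_mult_def U_def)
    ultimately show False using mult_U [of 1 1 1] by simp
  qed
  assume quat: "snd (bs ! k) = Quaternion_Div"
  have "p * q = q * p" for p q :: quat
  proof -
    have "mat_mult (bs ! k) (U 0 0 p) (U 0 0 q) = mat_mult (bs ! k) (U 0 0 q) (U 0 0 p)"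
      using fst_block [OF k] quat by (intro mat_comm U) auto
    then show ?thesis using mult_U by metis
  qed
  from this [of "Quat 0 1 0 0" "Quat 0 0 1 0"] show False
    by (simp add: quat_eq_iff)
next
  assume *: "\<forall>k<length bs. fst (bs ! k) = 1 \<and> snd (bs ! k) \<noteq> Quaternion_Div"
  fix a b :: 'a
  have "\<phi> (a * b) k = \<phi> (b * a) k" for k
  proof (cases "k < length bs")
    case True
    have "\<phi> a k i 0 * \<phi> b k 0 j = \<phi> b k i 0 * \<phi> a k 0 j" for i j
    proof (cases "i = 0 \<and> j = 0")
      case True
      have "\<phi> c k 0 0 \<in> div_ring_set (snd (bs ! k))" for c
        using phi_in_carrier [OF \<open>k < length bs\<close>, of c] * \<open>k < length bs\<close> by (auto simp: mat_carrier_def split: if_splits)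
      then have "\<phi> a k 0 0 * \<phi> b k 0 0 = \<phi> b k 0 0 * \<phi> a k 0 0"
        using * \<open>k < length bs\<close> by (intro div_ring_set_commute) auto
      then show ?thesis using True by simp
    next
      case False
      moreover have "\<phi> c k i j = 0" if "\<not> (i = 0 \<and> j = 0)" for c i j
        using phi_in_carrier [OF \<open>k < length bs\<close>, of c] * \<open>k < length bs\<close> that
        by (auto simp: mat_carrier_def)
      ultimately show ?thesis by (cases "i = 0") simp_all
    qed
    then show ?thesis using True * by (simp add: phi_mult mat_mult_def fun_eq_iff)
  qed (simp add: phi_beyond)
  then show "a * b = b * a" by (simp add: phi_inject [symmetric] fun_eq_iff)
qed

end

section \<open>Direct sums of blocks of size one\<close>

lemma norm_le_norm_add_scaleR_iff:
  fixes c d :: "'b::real_inner"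
  shows "(\<forall>t. norm c \<le> norm (c + t *\<^sub>R d)) \<longleftrightarrow> inner c d = 0"
proof
  assume le: "\<forall>t. norm c \<le> norm (c + t *\<^sub>R d)"
  show "inner c d = 0"
  proof (cases "d = 0")
    case False
    then have d: "inner d d > 0" by simp
    let ?t = "- inner c d / inner d d"
    have "(norm c)\<^sup>2 \<le> (norm (c + ?t *\<^sub>R d))\<^sup>2"
      by (rule power_mono [OF spec [OF le]]) simp
    also have "\<dots> = inner c c + 2 * ?t * inner c d + ?t * (?t * inner d d)"
      unfolding power2_norm_eq_inner inner_add_left inner_add_right inner_scaleR_left inner_scaleR_right
      by (simp add: inner_commute)
    also have "?t * inner d d = - inner c d" using d by simp
    finally have "0 \<le> ?t * inner c d"
      by (simp add: power2_norm_eq_inner)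
    then have "inner c d * inner c d \<le> 0"
      using d by (simp add: divide_simps split: if_splits)
    then show ?thesis
      by (metis mult_eq_0_iff not_square_less_zero order_le_less)
  qed simp
next
  assume "inner c d = 0"
  moreover have "0 \<le> t * (t * inner d d)" for t :: real
    by (simp flip: mult.assoc)
  ultimately show "\<forall>t. norm c \<le> norm (c + t *\<^sub>R d)"
    by (simp add: norm_le inner_add_left inner_add_right inner_commute)
qed

lemma mat_norm_size_one:
  assumes "fst b = 1" shows "mat_norm b A = norm (A 0 0)"
proof -
  have vn: "vec_norm b x = norm (x 0)" for x
    by (simp add: vec_norm_def assms L2_set_def)
  obtain x where "vec_norm b x = 1" "vec_norm b (mat_vec b A x) = mat_norm b A"
    using mat_norm_attained [of b A] assms by auto
  then show ?thesis by (simp add: vn mat_vec_def assms norm_mult)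
qed

text \<open>The norm of the division ring is multiplicative, so every vector attains the norm of a matrix of size one.\<close>

lemma has_right_dim_norm_attaining_size_one:
  assumes "fst b = 1" shows "has_right_dim (div_ring_set (snd b)) (norm_attaining b A) 1"
proof -
  let ?e = "\<lambda>i::nat. if i = 0 then 1 else (0::quat)"
  have V: "norm_attaining b A = vec_carrier b"
    by (auto simp: norm_attaining_def mat_norm_size_one [OF assms] vec_norm_def mat_vec_def assms
        L2_set_def norm_mult)
  have comb: "right_comb {?e} c = (\<lambda>i. if i = 0 then c ?e else 0)" for c
    by (auto simp: right_comb_def)
  have "vec_carrier b = {right_comb {?e} c |c. \<forall>v\<in>{?e}. c v \<in> div_ring_set (snd b)}"
  proof (intro set_eqI iffI)
    fix x assume "x \<in> vec_carrier b"
    then have "x = right_comb {?e} (\<lambda>_. x 0)" "x 0 \<in> div_ring_set (snd b)"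
      unfolding comb by (auto simp: vec_carrier_def assms)
    then show "x \<in> {right_comb {?e} c |c. \<forall>v\<in>{?e}. c v \<in> div_ring_set (snd b)}"
      by blast
  qed (auto simp: comb vec_carrier_def assms)
  moreover have "?e \<in> vec_carrier b"
    by (simp add: vec_carrier_def assms)
  moreover have "c ?e = 0" if "right_comb {?e} c = (\<lambda>_. 0)" for c
    using that unfolding comb by (metis (full_types))
  ultimately show ?thesis
    unfolding has_right_dim_def V by (intro exI [of _ "{?e}"]) auto
qed

text \<open>
  The real orthogonal complement of a nonzero number inside \<open>\<real>\<close> or \<open>\<complex>\<close> is at most a line, whereas
  inside the quaternions it has dimension three. This is the difference that the exchange
  of entries of a minimal tuple detects.
\<close>

lemma orthogonal_in_span_commutative:
  assumes "K \<noteq> Quaternion_Div" "a \<in> div_ring_set K" "u \<in> div_ring_set K" "v \<in> div_ring_set K"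
    and "a \<noteq> 0" "u \<noteq> 0" "inner a u = 0" "inner a v = 0"
  shows "v \<in> span {u}"
proof -
  have "qIm2 q = 0 \<and> qIm3 q = 0" if "q \<in> div_ring_set K" for q
    using assms(1) that by (cases K) (auto simp: Reals_quat_iff range_quat_of_complex_iff)
  then have im: "qIm2 a = 0" "qIm3 a = 0" "qIm2 u = 0" "qIm3 u = 0" "qIm2 v = 0" "qIm3 v = 0"
    using assms(2-4) by simp_all
  define a1 a2 u1 u2 v1 v2 where c: "a1 = qRe a" "a2 = qIm1 a" "u1 = qRe u" "u2 = qIm1 u" "v1 = qRe v" "v2 = qIm1 v"
  have o: "a1 * u1 + a2 * u2 = 0" "a1 * v1 + a2 * v2 = 0"
    using assms(7,8) im by (simp_all add: inner_quat_def c)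
  have "a1 * (u1 * v2 - u2 * v1) = 0" "a2 * (u1 * v2 - u2 * v1) = 0"
    using o by algebra+
  moreover have "a1 \<noteq> 0 \<or> a2 \<noteq> 0"
    using assms(5) im by (auto simp: quat_eq_iff c)
  ultimately have det: "u1 * v2 = u2 * v1" by auto
  have "inner u u *\<^sub>R v = inner u v *\<^sub>R u"
    using im det by (auto simp: quat_eq_iff inner_quat_def c [symmetric]) algebra+
  then have "inverse (inner u u) *\<^sub>R inner u u *\<^sub>R v = inverse (inner u u) *\<^sub>R inner u v *\<^sub>R u"
    by simp
  then have "v = (inverse (inner u u) * inner u v) *\<^sub>R u"
    using assms(6) by simp
  then show ?thesis by (metis span_base span_scale singletonI)
qed

locale size_one_blocks = matrix_blocks +
  assumes size_one: "k < length bs \<Longrightarrow> fst (bs ! k) = 1"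
begin

definition coord :: "nat \<Rightarrow> 'a \<Rightarrow> quat" where
  "coord k a = \<phi> a k 0 0"

lemma coord_add: "coord k (a + b) = coord k a + coord k b"
  by (simp add: coord_def phi_add)

lemma coord_smul: "z \<in> F \<Longrightarrow> coord k (smul z a) = quat_of_complex z * coord k a"
  by (simp add: coord_def phi_smul)

lemma coord_scaleR: "coord k (r *\<^sub>R a) = r *\<^sub>R coord k a"
  using coord_smul [OF of_real_in_F, of k r a] unfolding smul_of_real quat_of_complex_of_real
  by (simp add: of_real_def)

lemma coord_minus: "coord k (a - b) = coord k a - coord k b"
  using coord_add [of k "a - b" b] by simp

lemma coord_zero [simp]: "coord k 0 = 0"
  by (simp add: coord_def phi_zero)

lemma coord_in: "k < length bs \<Longrightarrow> coord k a \<in> div_ring_set (snd (bs ! k))"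
  using phi_in_carrier [of k a] size_one by (auto simp: coord_def mat_carrier_def split: if_splits)

lemma norm_part_coord: "k < length bs \<Longrightarrow> norm (part k a) = norm (coord k a)"
  by (simp add: norm_part mat_norm_size_one size_one coord_def)

lemma coord_part: "j < length bs \<Longrightarrow> coord k (part j a) = (if k = j then coord k a else 0)"
  by (simp add: coord_def phi_part)

lemma coord_surj:
  assumes "k < length bs" "q \<in> div_ring_set (snd (bs ! k))"
  obtains a where "part k a = a" "coord k a = q"
proof -
  let ?E = "\<lambda>i j. if i = 0 \<and> j = 0 then q else (0::quat)"
  have "?E \<in> mat_carrier (bs ! k)"
    using assms size_one by (auto simp: mat_carrier_def)
  then show thesis
    using that [of "embed k ?E"] assms by (simp add: part_embed coord_def phi_embed)
qed

lemma coord_eq_0: "k < length bs \<Longrightarrow> part k a = a \<Longrightarrow> coord k a = 0 \<longleftrightarrow> a = 0"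
  using norm_part_coord [of k a] by auto

lemma coord_in_span:
  assumes "k < length bs" "part k u = u" "part k v = v"
  shows "coord k v \<in> span {coord k u} \<longleftrightarrow> v \<in> span {u}"
proof
  assume "coord k v \<in> span {coord k u}"
  then obtain r where "coord k v = r *\<^sub>R coord k u" by (auto simp: span_singleton)
  then have "coord k (v - r *\<^sub>R u) = 0" by (simp add: coord_minus coord_scaleR)
  moreover have "part k (v - r *\<^sub>R u) = v - r *\<^sub>R u"
    using assms by (simp add: part_minus part_scaleR)
  ultimately have "v - r *\<^sub>R u = 0" using coord_eq_0 [OF assms(1)] by blast
  then have "v = r *\<^sub>R u" by simp
  then show "v \<in> span {u}" by (metis span_base span_scale singletonI)
qed (auto simp: span_singleton coord_scaleR)

text \<open>
  On a block of size one the norm is Euclidean, so orthogonality over the reals is the vanishing of an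
  inner product; over \<open>F\<close> it has to hold for all multiples of \<open>w\<close> at once.
\<close>

lemma bj_orth_part_iff:
  assumes k: "k < length bs" "part k a = a"
  shows "bj_orth F smul a w \<longleftrightarrow> (\<forall>z\<in>F. inner (coord k a) (quat_of_complex z * coord k w) = 0)"
proof (cases "a = 0")
  case False
  have norm_add: "norm (a + smul z (part k w)) = norm (coord k a + quat_of_complex z * coord k w)"
    if "z \<in> F" for z
  proof -
    have "part k (a + smul z (part k w)) = a + smul z (part k w)"
      using k that by (simp add: part_add part_smul part_part)
    then show ?thesis
      using norm_part_coord [OF k(1), of "a + smul z (part k w)"] k that
      by (simp add: coord_add coord_smul coord_part)
  qed
  have norm_a: "norm a = norm (coord k a)" using norm_part_coord [OF k(1), of a] k(2) by simp
  have "bj_orth F smul a w \<longleftrightarrow> bj_orth F smul a (part k w)"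
    using bj_orth_peaked [OF peaked_at_part [OF k False]] k(2) by simp
  also have "\<dots> \<longleftrightarrow> (\<forall>z\<in>F. norm (coord k a) \<le> norm (coord k a + quat_of_complex z * coord k w))"
    by (simp add: bj_orth_def norm_add norm_a)
  also have "\<dots> \<longleftrightarrow> (\<forall>z\<in>F. \<forall>t. norm (coord k a) \<le> norm (coord k a + t *\<^sub>R (quat_of_complex z * coord k w)))"
  proof -
    have "quat_of_complex (of_real t * z) * c = t *\<^sub>R (quat_of_complex z * c)" for t z c
      by (simp add: quat_of_complex_def quat_eq_iff algebra_simps)
    then have "quat_of_complex z * c = 1 *\<^sub>R (quat_of_complex z * c)"
      "t *\<^sub>R (quat_of_complex z * c) = quat_of_complex (of_real t * z) * c" for t z c
      by simp_all
    then show ?thesis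
      using mult_in_F [OF of_real_in_F] by metis
  qed
  finally show ?thesis by (simp add: norm_le_norm_add_scaleR_iff)
qed simp

lemma bj_orth_peaked_iff:
  assumes "peaked_at k a"
  shows "bj_orth F smul a w \<longleftrightarrow> (\<forall>z\<in>F. inner (coord k a) (quat_of_complex z * coord k w) = 0)"
proof -
  have k: "k < length bs" using assms by (simp add: peaked_at_def)
  show ?thesis
    using bj_orth_peaked [OF assms, of w] bj_orth_part_iff [OF k, of "part k a" "part k w"] k
    by (simp add: part_part coord_part)
qed

lemma cnj_in_F [simp]: "z \<in> F \<Longrightarrow> cnj z \<in> F"
  using field_real_or_complex by (auto elim: Reals_cases)

text \<open>
  Inner products are symmetric, so inside the block of \<open>a\<close> nothing is to be shown except that a scalar
  changes sides as its conjugate. If the norm of \<open>w\<close> is attained in another block, then adding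
  multiples of \<open>a\<close> to \<open>w\<close> cannot decrease it.
\<close>

lemma left_symmetric_if_part:
  assumes k: "k < length bs" "part k a = a" shows "left_symmetric F smul a"
proof -
  have "bj_orth F smul w a" if aw: "bj_orth F smul a w" for w
  proof (cases "w = 0")
    case False
    then obtain i where i: "i < length bs" "norm (part i w) = norm w" by (rule norm_part_attained)
    have "bj_orth F smul (part i w) (part i a)"
    proof (cases "i = k")
      case True
      have "inner (coord k w) (quat_of_complex z * coord k a) = 0" if "z \<in> F" for z
      proof -
        have "inner (coord k w) (quat_of_complex z * coord k a)
            = inner (coord k a) (quat_of_complex (cnj z) * coord k w)"
          unfolding inner_mult_left_qcnj [of "coord k w"] qcnj_quat_of_complex
          by (rule inner_commute)
        then show ?thesis using aw that bj_orth_part_iff [OF k] by simp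
      qed
      then show ?thesis
        using True i k bj_orth_part_iff [OF k(1), of "part k w" a] by (simp add: part_part coord_part)
    qed (use part_eq_0 [OF k i(1)] in simp)
    then show ?thesis by (rule bj_orth_if_bj_orth_part [OF i])
  qed simp
  then show ?thesis by (auto simp: left_symmetric_def out_nbhd_def in_nbhd_def)
qed

text \<open>
  Each component of \<open>w\<close> is left-symmetric, but it is orthogonal to \<open>w\<close> only if it vanishes; so 0 is
  the only element orthogonal on the right to all left-symmetric ones.
\<close>

lemma biorth_left_symmetrics_eq_UNIV: "biorth_left_symmetrics F smul = UNIV"
proof -
  have "w = 0" if w: "w \<in> common_out F smul (left_symmetrics F smul UNIV)" for w
  proof (rule part_ext)
    fix k assume k: "k < length bs"
    then have "left_symmetric F smul (part k w)" by (simp add: left_symmetric_if_part part_part)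
    then have "bj_orth F smul (part k w) w"
      using w by (auto simp: common_out_def out_nbhd_def left_symmetrics_UNIV)
    then show "part k w = part k 0" using bj_orth_part_self k by simp
  qed
  then have "bj_orth F smul w x" if "w \<in> common_out F smul (left_symmetrics F smul UNIV)" for w x
    using that bj_orth_zero_left by metis
  then show ?thesis
    unfolding biorth_left_symmetrics_def common_out_def [of _ _ "common_out _ _ _"] out_nbhd_def by blast
qed

lemma smooth_iff_peaked_at: "smooth bs (\<phi> a) \<longleftrightarrow> (\<exists>i. peaked_at i a)"
proof -
  have "(\<forall>k<length bs. mat_norm (bs ! k) (\<phi> a k) = block_sum_norm bs (\<phi> a) \<longleftrightarrow> k = i) \<longleftrightarrow> peaked_at i a"
    if i: "i < length bs" for i
  proof -
    have "(\<forall>k<length bs. norm (part k a) = norm a \<longleftrightarrow> k = i) \<longleftrightarrow> peaked_at i a"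
    proof
      assume *: "\<forall>k<length bs. norm (part k a) = norm a \<longleftrightarrow> k = i"
      then have "norm (part i a) = norm a" using i by blast
      moreover have "norm (part j a) < norm a" if "j < length bs" "j \<noteq> i" for j
        using * that norm_part_le [OF that(1), of a] by (simp add: order_less_le)
      ultimately show "peaked_at i a" using i by (simp add: peaked_at_def)
    next
      assume *: "peaked_at i a"
      show "\<forall>k<length bs. norm (part k a) = norm a \<longleftrightarrow> k = i"
        using * unfolding peaked_at_norm [OF *, symmetric] peaked_at_def by (metis less_irrefl)
    qed
    then show ?thesis by (simp add: norm_part norm_phi [symmetric])
  qed
  moreover have "i < length bs" if "peaked_at i a" for i
    using that by (simp add: peaked_at_def)
  moreover have "has_right_dim (div_ring_set (snd (bs ! i))) (norm_attaining (bs ! i) (\<phi> a i)) 1"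
    if "i < length bs" for i
    using has_right_dim_norm_attaining_size_one [OF size_one [OF that]] .
  ultimately show ?thesis
    unfolding smooth_def by blast
qed

lemma common_out_peaked:
  assumes "\<forall>a\<in>T. \<exists>k. peaked_at k a"
  shows "subspace (common_out F smul T)"
    and "w \<in> common_out F smul T \<Longrightarrow> j < length bs \<Longrightarrow> part j w \<in> common_out F smul T"
proof -
  have mem: "w \<in> common_out F smul T \<longleftrightarrow>
      (\<forall>a\<in>T. \<forall>k. peaked_at k a \<longrightarrow> (\<forall>z\<in>F. inner (coord k a) (quat_of_complex z * coord k w) = 0))" for w
    using assms bj_orth_peaked_iff unfolding common_out_def out_nbhd_def by blast
  show "subspace (common_out F smul T)"
    unfolding subspace_def Ball_def mem by (simp add: coord_add coord_scaleR inner_add_right distrib_left)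
  show "part j w \<in> common_out F smul T" if "w \<in> common_out F smul T" "j < length bs"
    using that unfolding mem by (simp add: coord_part)
qed

lemma peaked_at_if_left_symmetric:
  assumes "left_symmetric F smul X" "X \<noteq> 0"
  obtains j where "j < length bs" "part j X = X" "peaked_at j X"
proof -
  have "X \<in> left_symmetrics F smul UNIV" using assms(1) by (simp add: left_symmetrics_UNIV)
  then obtain j where "j < length bs" "part j X = X"
    using left_symmetrics_concentrated [of UNIV X] assms(2) by auto
  then show thesis using that peaked_at_part assms(2) by simp
qed

text \<open>
  A set that contains the components of its elements has no left-symmetric elements but those
  concentrated in one block, so finiteness can be checked block by block.
\<close>

lemma property_FL_if_finite:
  assumes closed: "\<And>w k. w \<in> S \<Longrightarrow> k < length bs \<Longrightarrow> part k w \<in> S"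
    and fin: "\<And>k. k < length bs \<Longrightarrow> finite (out_nbhd F smul ` {v \<in> S. part k v = v})"
  shows "property_FL F smul S"
proof -
  have "left_symmetrics F smul S \<subseteq> insert 0 (\<Union>k<length bs. {v \<in> S. part k v = v})"
  proof
    fix X assume X: "X \<in> left_symmetrics F smul S"
    then have "X \<in> S" by (simp add: left_symmetrics_def)
    then show "X \<in> insert 0 (\<Union>k<length bs. {v \<in> S. part k v = v})"
      using left_symmetrics_concentrated [of S X] closed X by blast
  qed
  then have "out_nbhd F smul ` left_symmetrics F smul S
      \<subseteq> insert (out_nbhd F smul 0) (\<Union>k<length bs. out_nbhd F smul ` {v \<in> S. part k v = v})"
    by blast
  moreover have "finite \<dots>" using fin by simp
  ultimately show ?thesis unfolding property_FL_def by (rule finite_subset)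
qed

text \<open>A complex block of size one is a complex line, so its nonzero elements share their neighbourhood.\<close>

lemma property_FL_UNIV_complex:
  assumes "F = UNIV" shows "property_FL F smul UNIV"
proof (rule property_FL_if_finite)
  fix k assume k: "k < length bs"
  have "out_nbhd F smul v = {w. coord k w = 0}" if v: "part k v = v" "v \<noteq> 0" for v
  proof -
    have c: "coord k v \<noteq> 0" using coord_eq_0 [OF k v(1)] v(2) by simp
    have "coord k w = 0" if w: "\<forall>z\<in>F. inner (coord k v) (quat_of_complex z * coord k w) = 0" for w
    proof -
      have "coord k v * qcnj (coord k w) \<in> range quat_of_complex"
        using coord_in [OF k] snd_block_complex [OF assms k] div_ring_set_closed(1,7)
        by (metis div_ring_set.simps(2))
      then obtain z where z: "coord k v * qcnj (coord k w) = quat_of_complex z" by auto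
      have "inner (coord k v) (quat_of_complex z * coord k w) = 0" using w assms by simp
      then have "inner (coord k v) (coord k v * (qcnj (coord k w) * coord k w)) = 0"
        by (simp add: z [symmetric] mult.assoc)
      then show ?thesis using c by (simp add: qcnj_times_self of_real_def)
    qed
    then show ?thesis
      using bj_orth_part_iff [OF k v(1)] by (auto simp: out_nbhd_def)
  qed
  then have "out_nbhd F smul ` {v \<in> UNIV. part k v = v} \<subseteq> {out_nbhd F smul 0, {w. coord k w = 0}}"
    by auto
  then show "finite (out_nbhd F smul ` {v \<in> UNIV. part k v = v})"
    by (rule finite_subset) simp
qed simp

end

locale real_size_one_blocks = size_one_blocks +
  assumes field_real: "F = \<real>"
begin

lemma bj_orth_peaked_real:
  assumes "peaked_at k a"
  shows "bj_orth F smul a w \<longleftrightarrow> inner (coord k a) (coord k w) = 0"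
  unfolding bj_orth_peaked_iff [OF assms]
proof
  assume "\<forall>z\<in>F. inner (coord k a) (quat_of_complex z * coord k w) = 0"
  then have "inner (coord k a) (quat_of_complex (of_real 1) * coord k w) = 0"
    using of_real_in_F by blast
  then show "inner (coord k a) (coord k w) = 0"
    unfolding quat_of_complex_of_real by simp
next
  assume *: "inner (coord k a) (coord k w) = 0"
  show "\<forall>z\<in>F. inner (coord k a) (quat_of_complex z * coord k w) = 0"
  proof
    fix z assume "z \<in> F"
    then obtain r where "z = of_real r" by (auto simp: field_real elim: Reals_cases)
    then have "quat_of_complex z * coord k w = r *\<^sub>R coord k w"
      by (simp only: quat_of_complex_of_real) (simp add: of_real_def)
    then show "inner (coord k a) (quat_of_complex z * coord k w) = 0" using * by simp
  qed
qed

lemma bj_orth_part_real: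
  assumes "k < length bs" "part k a = a"
  shows "bj_orth F smul a w \<longleftrightarrow> inner (coord k a) (coord k w) = 0"
  using assms bj_orth_peaked_real [OF peaked_at_part [OF assms]] by (cases "a = 0") auto

text \<open>
  Proportional elements of a block have the same outgoing neighbourhood. Conversely, if \<open>u\<close> and \<open>v\<close>
  are independent, the elements \<open>u + t v\<close> are pairwise independent, and each of them is recovered up
  to a factor from its neighbourhood, as the orthogonal complement of its orthogonal complement.
\<close>

lemma property_FL_iff:
  assumes S: "subspace S" and closed: "\<And>w k. w \<in> S \<Longrightarrow> k < length bs \<Longrightarrow> part k w \<in> S"
  shows "property_FL F smul S \<longleftrightarrow>
    (\<forall>k<length bs. \<forall>u\<in>S. \<forall>v\<in>S. part k u = u \<longrightarrow> part k v = v \<longrightarrow> u \<noteq> 0 \<longrightarrow> v \<in> span {u})"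
proof (intro iffI allI ballI impI)
  assume lines: "\<forall>k<length bs. \<forall>u\<in>S. \<forall>v\<in>S. part k u = u \<longrightarrow> part k v = v \<longrightarrow> u \<noteq> 0 \<longrightarrow> v \<in> span {u}"
  show "property_FL F smul S"
  proof (rule property_FL_if_finite [OF closed])
    fix k assume k: "k < length bs"
    show "finite (out_nbhd F smul ` {v \<in> S. part k v = v})"
    proof (cases "\<exists>u\<in>S. part k u = u \<and> u \<noteq> 0")
      case False
      then have "out_nbhd F smul ` {v \<in> S. part k v = v} \<subseteq> {out_nbhd F smul 0}" by auto
      then show ?thesis by (rule finite_subset) simp
    next
      case True
      then obtain u where u: "u \<in> S" "part k u = u" "u \<noteq> 0" by blast
      have "out_nbhd F smul v \<in> {out_nbhd F smul 0, out_nbhd F smul u}" if v: "v \<in> S" "part k v = v" for v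
      proof -
        obtain r where r: "v = r *\<^sub>R u" using lines k u v by (fastforce simp: span_singleton)
        then have "r \<noteq> 0 \<Longrightarrow> out_nbhd F smul v = out_nbhd F smul u"
          unfolding out_nbhd_def bj_orth_part_real [OF k v(2)] bj_orth_part_real [OF k u(2)]
          by (simp add: r coord_scaleR)
        then show ?thesis using r by (cases "r = 0") simp_all
      qed
      then have "out_nbhd F smul ` {v \<in> S. part k v = v} \<subseteq> {out_nbhd F smul 0, out_nbhd F smul u}" by blast
      then show ?thesis by (rule finite_subset) simp
    qed
  qed
next
  fix k u v
  assume FL: "property_FL F smul S" and k: "k < length bs" and uS: "u \<in> S" and vS: "v \<in> S"
    and u: "part k u = u" and v: "part k v = v" and nz: "u \<noteq> 0"
  show "v \<in> span {u}"
  proof (rule ccontr)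
    assume indep: "v \<notin> span {u}"
    define f where "f t = u + t *\<^sub>R v" for t
    have f: "f t \<in> S" "part k (f t) = f t" for t
    proof -
      show "f t \<in> S" using S uS vS by (simp add: f_def subspace_add subspace_scale)
      show "part k (f t) = f t"
        using k u v by (simp add: f_def part_add part_scaleR)
    qed
    have comb: "\<alpha> = 0 \<and> \<beta> = 0" if "\<alpha> *\<^sub>R u + \<beta> *\<^sub>R v = 0" for \<alpha> \<beta>
    proof (cases "\<beta> = 0")
      case False
      have "\<beta> *\<^sub>R v = (- \<alpha>) *\<^sub>R u" using that by (simp add: eq_neg_iff_add_eq_0 add.commute)
      then have "v = (inverse \<beta> * (- \<alpha>)) *\<^sub>R u"
        using False by (metis scaleR_scaleR left_inverse scaleR_one)
      then show ?thesis using indep by (metis span_base span_scale singletonI)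
    qed (use that nz in simp)
    have "inj (\<lambda>t. out_nbhd F smul (f t))"
    proof (rule injI)
      fix s t assume eq: "out_nbhd F smul (f s) = out_nbhd F smul (f t)"
      define a b where "a = coord k (f s)" and "b = coord k (f t)"
      have "f s \<noteq> 0" using comb [of 1 s] by (auto simp: f_def)
      then have a: "inner a a \<noteq> 0" using coord_eq_0 [OF k f(2), of s] by (simp add: a_def)
      \<comment> \<open>The component \<open>d\<close> of \<open>f t\<close> orthogonal to \<open>f s\<close> is, by assumption, orthogonal to \<open>f t\<close>, too.\<close>
      define \<mu> where "\<mu> = inner a b / inner a a"
      define d where "d = f t - \<mu> *\<^sub>R f s"
      have d: "coord k d = b - \<mu> *\<^sub>R a" by (simp add: d_def coord_minus coord_scaleR a_def b_def)
      have "inner a (coord k d) = 0" using a by (simp add: d inner_diff_right \<mu>_def)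
      then have "d \<in> out_nbhd F smul (f s)"
        using bj_orth_part_real [OF k f(2)] by (simp add: out_nbhd_def a_def)
      then have "d \<in> out_nbhd F smul (f t)" using eq by simp
      then have "inner b (coord k d) = 0"
        using bj_orth_part_real [OF k f(2)] by (simp add: out_nbhd_def b_def)
      with \<open>inner a (coord k d) = 0\<close> have "inner (coord k d) (coord k d) = 0"
        by (subst (1) d) (simp add: inner_diff_left)
      then have "coord k d = 0" by simp
      moreover have "part k d = d"
        using k f(2) by (simp add: d_def part_minus part_scaleR)
      ultimately have "d = 0" using coord_eq_0 [OF k] by blast
      then have "(1 - \<mu>) *\<^sub>R u + (t - \<mu> * s) *\<^sub>R v = 0"
        by (simp add: d_def f_def algebra_simps)
      then show "s = t" using comb [of "1 - \<mu>" "t - \<mu> * s"] by simp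
    qed
    then have "infinite (range (\<lambda>t. out_nbhd F smul (f t)))"
      using finite_imageD infinite_UNIV_char_0 by blast
    moreover have "range (\<lambda>t. out_nbhd F smul (f t)) \<subseteq> out_nbhd F smul ` left_symmetrics F smul S"
    proof -
      have "f t \<in> left_symmetrics F smul S" for t
        using f(1) left_symmetric_if_part [OF k f(2)] by (auto simp: left_symmetrics_def left_symmetric_def)
      then show ?thesis by blast
    qed
    ultimately show False
      using FL unfolding property_FL_def by (blast dest: finite_subset)
  qed
qed

end

section \<open>Minimal tuples\<close>

context size_one_blocks
begin

abbreviation others :: "'a list \<Rightarrow> nat \<Rightarrow> 'a set" where
  "others As p \<equiv> (!) As ` ({..<length As} - {p})"

lemma set_eq_insert_others: "p < length As \<Longrightarrow> set As = insert (As ! p) (others As p)"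
  by (auto simp: set_conv_nth)

lemma out_except_eq: "out_except F smul As X p = common_out F smul (insert X (others As p))"
  by (auto simp: out_except_def common_out_def)

lemma FL_tuple_iff:
  "FL_tuple F smul bs \<phi> As \<longleftrightarrow>
    (\<forall>a\<in>set As. \<exists>k. peaked_at k a) \<and> property_FL F smul (common_out F smul (set As))"
proof -
  have "(\<Inter>k<length As. out_nbhd F smul (As ! k)) = common_out F smul (set As)"
    by (auto simp: common_out_def set_conv_nth)
  then show ?thesis by (simp add: FL_tuple_def smooth_iff_peaked_at)
qed

lemma minimal_FL_tuple_drop:
  assumes "minimal_FL_tuple F smul bs \<phi> As" "p < length As"
  shows "\<not> property_FL F smul (common_out F smul (others As p))"
proof
  assume FL: "property_FL F smul (common_out F smul (others As p))"
  have set: "set (nths As (- {p})) = others As p"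
    by (auto simp: set_nths)
  have "FL_tuple F smul bs \<phi> (nths As (- {p}))"
    using assms FL set_eq_insert_others [OF assms(2)] by (simp add: FL_tuple_iff set minimal_FL_tuple_def)
  then have "length As \<le> length (nths As (- {p}))"
    using assms(1) by (simp add: minimal_FL_tuple_def)
  moreover have "length (nths As (- {p})) < length As"
  proof -
    have "{i. i < length As \<and> i \<in> - {p}} = {..<length As} - {p}" by auto
    then show ?thesis using assms(2) by (simp add: length_nths)
  qed
  ultimately show False by simp
qed

lemma minimal_FL_tuple_complex:
  assumes "F = UNIV" "minimal_FL_tuple F smul bs \<phi> As" shows "As = []"
proof -
  have "FL_tuple F smul bs \<phi> []"
    using property_FL_UNIV_complex [OF assms(1)] by (simp add: FL_tuple_iff common_out_def)
  then show ?thesis using assms(2) by (force simp: minimal_FL_tuple_def)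
qed

end

context real_size_one_blocks
begin

lemma property_FL_common_out_iff:
  assumes "\<forall>a\<in>T. \<exists>k. peaked_at k a"
  shows "property_FL F smul (common_out F smul T) \<longleftrightarrow>
    (\<forall>k<length bs. \<forall>u\<in>common_out F smul T. \<forall>v\<in>common_out F smul T.
      part k u = u \<longrightarrow> part k v = v \<longrightarrow> u \<noteq> 0 \<longrightarrow> v \<in> span {u})"
  by (rule property_FL_iff) (use common_out_peaked [OF assms] in auto)

text \<open>
  By minimality, the intersection without the entry \<open>p\<close> contains two independent elements \<open>u\<close>, \<open>v\<close>
  of some block \<open>m\<close>. Both the entry \<open>p\<close> and the element \<open>X\<close> restore the property, so both must act on
  block \<open>m\<close>. No other entry acts on it, since a single real equation would have left at most a line
  of the commutative block \<open>m\<close>.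
\<close>

lemma replaced_entry_sole_at_block:
  assumes noquat: "\<forall>k<length bs. snd (bs ! k) \<noteq> Quaternion_Div"
    and min: "minimal_FL_tuple F smul bs \<phi> As" and p: "p < length As"
    and X: "j < length bs" "part j X = X" "X \<noteq> 0"
    and FL: "property_FL F smul (out_except F smul As X p)"
  shows "peaked_at j (As ! p)" "coord j (As ! p) \<noteq> 0"
    and "q < length As \<Longrightarrow> q \<noteq> p \<Longrightarrow> peaked_at j (As ! q) \<Longrightarrow> coord j (As ! q) = 0"
proof -
  let ?S = "common_out F smul (others As p)"
  have peaked: "\<forall>a\<in>set As. \<exists>k. peaked_at k a" and FL_As: "property_FL F smul (common_out F smul (set As))"
    using min by (simp_all add: minimal_FL_tuple_def FL_tuple_iff)
  have peaked_others: "\<forall>a\<in>others As p. \<exists>k. peaked_at k a"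
    using peaked set_eq_insert_others [OF p] by simp
  obtain m u v where m: "m < length bs" and S: "u \<in> ?S" "v \<in> ?S"
    and u: "part m u = u" "u \<noteq> 0" and v: "part m v = v" "v \<notin> span {u}"
    using minimal_FL_tuple_drop [OF min p] unfolding property_FL_common_out_iff [OF peaked_others] by blast
  have hit: "k = m \<and> coord m a \<noteq> 0"
    if "peaked_at k a" "property_FL F smul (common_out F smul (insert a (others As p)))" for k a
  proof -
    have "\<forall>b\<in>insert a (others As p). \<exists>k. peaked_at k b" using peaked_others that(1) by blast
    then have "\<not> (u \<in> common_out F smul (insert a (others As p)) \<and> v \<in> common_out F smul (insert a (others As p)))"
      using that(2) property_FL_common_out_iff m u v by blast
    then have "\<not> (bj_orth F smul a u \<and> bj_orth F smul a v)"
      using S by (auto simp: common_out_def out_nbhd_def)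
    then have *: "inner (coord k a) (coord k u) \<noteq> 0 \<or> inner (coord k a) (coord k v) \<noteq> 0"
      by (simp add: bj_orth_peaked_real [OF that(1)])
    moreover have "coord k u = 0 \<and> coord k v = 0" if "k \<noteq> m"
      using coord_part [OF m, of k u] coord_part [OF m, of k v] u v that by simp
    ultimately show ?thesis by fastforce
  qed
  obtain i where i: "peaked_at i (As ! p)" using peaked nth_mem [OF p] by blast
  then have "i = m" "coord m (As ! p) \<noteq> 0"
    using hit FL_As set_eq_insert_others [OF p] by auto
  moreover have "j = m"
    using hit [OF peaked_at_part [OF X]] FL by (simp add: out_except_eq)
  ultimately show "peaked_at j (As ! p)" "coord j (As ! p) \<noteq> 0" using i by simp_all
  show "coord j (As ! q) = 0" if q: "q < length As" "q \<noteq> p" "peaked_at j (As ! q)"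
  proof (rule ccontr)
    assume nz: "coord j (As ! q) \<noteq> 0"
    have "As ! q \<in> others As p" using q by blast
    then have "bj_orth F smul (As ! q) u" "bj_orth F smul (As ! q) v"
      using S by (auto simp: common_out_def out_nbhd_def)
    then have "inner (coord j (As ! q)) (coord j u) = 0" "inner (coord j (As ! q)) (coord j v) = 0"
      using bj_orth_peaked_real [OF q(3)] by simp_all
    then have "coord j v \<in> span {coord j u}"
      using noquat X(1) coord_in [OF X(1)] nz coord_eq_0 [OF m u(1)] u(2) \<open>j = m\<close>
      by (intro orthogonal_in_span_commutative [of "snd (bs ! j)" "coord j (As ! q)"]) auto
    then show False using coord_in_span [OF m u(1) v(1)] v(2) \<open>j = m\<close> by simp
  qed
qed

text \<open>
  Each of the entries \<open>p\<close> and \<open>q\<close> would be the only one that acts on the block of \<open>X\<close>.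
\<close>

lemma no_exchange_without_quaternions:
  assumes noquat: "\<forall>k<length bs. snd (bs ! k) \<noteq> Quaternion_Div"
    and min: "minimal_FL_tuple F smul bs \<phi> As" and pq: "p < length As" "q < length As" "p \<noteq> q"
    and X: "X \<noteq> 0" "left_symmetric F smul X"
    and FL: "property_FL F smul (out_except F smul As X p)" "property_FL F smul (out_except F smul As X q)"
  shows False
proof -
  obtain j where j: "j < length bs" "part j X = X"
    using peaked_at_if_left_symmetric X by metis
  have "coord j (As ! q) = 0"
    using replaced_entry_sole_at_block(3) [OF noquat min pq(1) j X(1) FL(1) pq(2)]
      replaced_entry_sole_at_block(1) [OF noquat min pq(2) j X(1) FL(2)] pq(3) by simp
  then show False
    using replaced_entry_sole_at_block(2) [OF noquat min pq(2) j X(1) FL(2)] by simp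
qed

text \<open>
  The elements that have a basis vector in one block and zeros elsewhere are smooth, and nothing but 0
  is orthogonal to all of them.
\<close>

lemma FL_tuple_exists: "\<exists>As. FL_tuple F smul bs \<phi> As"
proof -
  define Q where "Q k B \<longleftrightarrow> finite B \<and> B \<subseteq> {a. part k a = a \<and> a \<noteq> 0} \<and>
      (\<forall>w. (\<forall>a\<in>B. inner (coord k a) (coord k w) = 0) \<longrightarrow> coord k w = 0)" for k B
  have "\<exists>B. Q k B" if k: "k < length bs" for k
  proof -
    obtain C where C: "C \<subseteq> div_ring_set (snd (bs ! k))" "independent C" "div_ring_set (snd (bs ! k)) \<subseteq> span C"
      using basis_exists [of "div_ring_set (snd (bs ! k))"] by metis
    have "\<forall>c\<in>C. \<exists>a. part k a = a \<and> coord k a = c"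
      using C(1) coord_surj [OF k] by blast
    then obtain g where g: "\<And>c. c \<in> C \<Longrightarrow> part k (g c) = g c \<and> coord k (g c) = c" by metis
    have "coord k w = 0" if "\<forall>a\<in>g ` C. inner (coord k a) (coord k w) = 0" for w
    proof -
      have "\<forall>c\<in>C. orthogonal (coord k w) c"
        using that g by (auto simp: orthogonal_def inner_commute)
      then have "orthogonal (coord k w) (coord k w)"
        using C(3) coord_in [OF k] orthogonal_to_span by blast
      then show ?thesis by (simp add: orthogonal_def)
    qed
    moreover have "g c \<noteq> 0" if "c \<in> C" for c
      using g [OF that] C(2) that dependent_zero coord_zero by metis
    moreover have "finite (g ` C)" using C(2) independent_imp_finite by blast
    moreover have "g ` C \<subseteq> {a. part k a = a \<and> a \<noteq> 0}" using g calculation(2) by auto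
    ultimately have "Q k (g ` C)" unfolding Q_def by simp
    then show ?thesis ..
  qed
  then have "\<forall>k\<in>{..<length bs}. \<exists>B. Q k B" by simp
  then obtain B where "\<forall>k\<in>{..<length bs}. Q k (B k)" using bchoice by metis
  then have B: "\<And>k. k < length bs \<Longrightarrow> finite (B k)"
      "\<And>k. k < length bs \<Longrightarrow> B k \<subseteq> {a. part k a = a \<and> a \<noteq> 0}"
      "\<And>k w. k < length bs \<Longrightarrow> (\<forall>a\<in>B k. inner (coord k a) (coord k w) = 0) \<Longrightarrow> coord k w = 0"
    unfolding Q_def by auto
  obtain As where As: "set As = (\<Union>k<length bs. B k)"
    using B(1) finite_list [of "\<Union>k<length bs. B k"] by auto
  have "w = 0" if w: "w \<in> common_out F smul (set As)" for w
  proof (rule part_ext)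
    fix k assume k: "k < length bs"
    have "inner (coord k a) (coord k w) = 0" if a: "a \<in> B k" for a
    proof -
      have "bj_orth F smul a w" using w a k by (auto simp: As common_out_def out_nbhd_def)
      then show ?thesis using bj_orth_part_real [OF k, of a] B(2) [OF k] a by auto
    qed
    then have "coord k w = 0" using B(3) [OF k] by blast
    then show "part k w = part k 0" using norm_part_coord [OF k, of w] k by simp
  qed
  then have "left_symmetrics F smul (common_out F smul (set As)) \<subseteq> {0}"
    by (auto simp: left_symmetrics_def)
  then have "property_FL F smul (common_out F smul (set As))"
    unfolding property_FL_def by (meson finite.emptyI finite_imageI finite_insert finite_subset)
  moreover have "\<forall>a\<in>set As. \<exists>k. peaked_at k a"
    using B(2) peaked_at_part unfolding As by blast
  ultimately show ?thesis by (auto simp: FL_tuple_iff)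
qed

text \<open>
  Two real equations on a space of dimension four leave a subspace of dimension at least two, which
  is more than property \<open>\<F>\<L>\<close> admits.
\<close>

lemma three_entries_at_quaternion_block:
  assumes m: "m < length bs" "snd (bs ! m) = Quaternion_Div"
    and As: "FL_tuple F smul bs \<phi> As"
  obtains p q r where "{p, q, r} \<subseteq> {..<length As}" "p \<noteq> q" "p \<noteq> r" "q \<noteq> r"
    "peaked_at m (As ! p)" "peaked_at m (As ! q)" "peaked_at m (As ! r)"
proof -
  let ?I = "{k. k < length As \<and> peaked_at m (As ! k)}"
  have peaked: "\<forall>a\<in>set As. \<exists>k. peaked_at k a" and FL: "property_FL F smul (common_out F smul (set As))"
    using As by (simp_all add: FL_tuple_iff)
  have "3 \<le> card ?I"
  proof (rule ccontr)
    assume few: "\<not> 3 \<le> card ?I"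
    let ?C = "(\<lambda>k. coord m (As ! k)) ` ?I"
    let ?W = "{y. \<forall>x\<in>span ?C. orthogonal x y}"
    have "dim (span ?C) \<le> card ?I"
      using dim_le_card' [of ?C] card_image_le [of ?I "\<lambda>k. coord m (As ! k)"] by simp
    moreover have "dim {y \<in> UNIV. \<forall>x\<in>span ?C. orthogonal x y} + dim (span ?C) = dim (UNIV :: quat set)"
      by (rule dim_subspace_orthogonal_to_vectors) auto
    ultimately have dim_W: "2 \<le> dim ?W" using few by (simp add: DIM_quat)
    have "\<not> ?W \<subseteq> {0}"
    proof
      assume "?W \<subseteq> {0}"
      then have "dim ?W = 0" by simp
      then show False using dim_W by linarith
    qed
    then obtain x where x: "x \<in> ?W" "x \<noteq> 0" by blast
    have "\<not> ?W \<subseteq> span {x}"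
    proof
      assume "?W \<subseteq> span {x}"
      then have "dim ?W \<le> card {x}" by (intro dim_le_card) auto
      then show False using dim_W by simp
    qed
    then obtain y where y: "y \<in> ?W" "y \<notin> span {x}" by blast
    obtain u where u: "part m u = u" "coord m u = x" using coord_surj [OF m(1), of x] m(2) by auto
    obtain v where v: "part m v = v" "coord m v = y" using coord_surj [OF m(1), of y] m(2) by auto
    have in_common: "w \<in> common_out F smul (set As)" if w: "part m w = w" "coord m w \<in> ?W" for w
    proof -
      have "bj_orth F smul (As ! k) w" if k: "k < length As" for k
      proof -
        obtain i where i: "peaked_at i (As ! k)" using peaked nth_mem [OF k] by blast
        show ?thesis
        proof (cases "i = m")
          case True
          then have "coord m (As ! k) \<in> span ?C" using i k by (intro span_base) auto
          then show ?thesis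
            using w(2) True by (simp add: bj_orth_peaked_real [OF i] orthogonal_def)
        next
          case False
          then have "coord i w = 0" using coord_part [OF m(1), of i w] w(1) by simp
          then show ?thesis by (simp add: bj_orth_peaked_real [OF i])
        qed
      qed
      then show ?thesis by (auto simp: common_out_def out_nbhd_def in_set_conv_nth)
    qed
    have "u \<noteq> 0" using u(2) x(2) by auto
    moreover have "v \<notin> span {u}" using coord_in_span [OF m(1) u(1) v(1)] u(2) v(2) y(2) by simp
    ultimately show False
      using FL in_common [OF u(1)] in_common [OF v(1)] u v x(1) y(1) m(1)
      unfolding property_FL_common_out_iff [OF peaked] by blast
  qed
  then obtain T where T: "T \<subseteq> ?I" "card T = 3" by (rule obtain_subset_with_card_n)
  then obtain p q r where "T = {p, q, r}" "p \<noteq> q" "q \<noteq> r" "p \<noteq> r" by (auto simp: card_3_iff)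
  then show thesis using that T(1) by auto
qed

text \<open>
  Take \<open>X\<close> to be the sum of the components in block \<open>m\<close> of three entries peaked there. Where two of the
  three equations hold, the third one is equivalent to the equation of \<open>X\<close>; so replacing one of the
  entries by \<open>X\<close> does not change the intersection at all. Minimality ensures \<open>X \<noteq> 0\<close>, because
  otherwise each of the three equations would follow from the other two.
\<close>

lemma exchange_with_quaternions:
  assumes m: "m < length bs" "snd (bs ! m) = Quaternion_Div"
  obtains As p q r X where "minimal_FL_tuple F smul bs \<phi> As"
    "p < length As" "q < length As" "r < length As" "p \<noteq> q" "p \<noteq> r" "q \<noteq> r"
    "X \<noteq> 0" "left_symmetric F smul X"
    "property_FL F smul (out_except F smul As X p)"
    "property_FL F smul (out_except F smul As X q)"
    "property_FL F smul (out_except F smul As X r)"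
proof -
  obtain As where As: "minimal_FL_tuple F smul bs \<phi> As"
    using FL_tuple_exists ex_has_least_nat [of "FL_tuple F smul bs \<phi>" _ length]
    unfolding minimal_FL_tuple_def by metis
  then have FL: "FL_tuple F smul bs \<phi> As" by (simp add: minimal_FL_tuple_def)
  obtain p q r where pqr: "{p, q, r} \<subseteq> {..<length As}" "p \<noteq> q" "p \<noteq> r" "q \<noteq> r"
    and peaked: "peaked_at m (As ! p)" "peaked_at m (As ! q)" "peaked_at m (As ! r)"
    using three_entries_at_quaternion_block [OF m FL] .
  define X where "X = part m (As ! p + As ! q + As ! r)"
  have X: "part m X = X" "coord m X = coord m (As ! p) + coord m (As ! q) + coord m (As ! r)"
    using m(1) by (simp_all add: X_def part_part coord_part coord_add)
  have exchange: "out_except F smul As X s = common_out F smul (set As)" if s: "s \<in> {p, q, r}" for s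
  proof -
    have "bj_orth F smul X w \<longleftrightarrow> bj_orth F smul (As ! s) w" if w: "w \<in> common_out F smul (others As s)" for w
    proof -
      have "inner (coord m (As ! k)) (coord m w) = 0" if "k \<in> {p, q, r} - {s}" for k
      proof -
        have "As ! k \<in> others As s" using pqr(1) that by blast
        then have "bj_orth F smul (As ! k) w"
          using w by (auto simp: common_out_def out_nbhd_def)
        moreover have "peaked_at m (As ! k)" using peaked that by blast
        ultimately show ?thesis using bj_orth_peaked_real by blast
      qed
      then have "inner (coord m X) (coord m w) = inner (coord m (As ! s)) (coord m w)"
        using s pqr(2-4) by (auto simp: X inner_add_left)
      moreover have "peaked_at m (As ! s)" using peaked s by blast
      ultimately show ?thesis
        using bj_orth_part_real [OF m(1) X(1)] bj_orth_peaked_real by simp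
    qed
    moreover have "s < length As" using s pqr(1) by auto
    ultimately show ?thesis
      unfolding out_except_eq set_eq_insert_others [OF \<open>s < length As\<close>]
      by (auto simp: common_out_def out_nbhd_def)
  qed
  have "X \<noteq> 0"
  proof
    assume "X = 0"
    then have "out_except F smul As X p = common_out F smul (others As p)"
      by (auto simp: out_except_eq common_out_def out_nbhd_def)
    then show False
      using minimal_FL_tuple_drop [OF As, of p] exchange [of p] FL pqr(1) by (simp add: FL_tuple_iff)
  qed
  moreover have "property_FL F smul (out_except F smul As X s)" if "s \<in> {p, q, r}" for s
    using FL exchange [OF that] by (simp add: FL_tuple_iff)
  ultimately show thesis
    using that [OF As, of p q r X] pqr left_symmetric_if_part [OF m(1) X(1)] by auto
qed

end

theorem corollary5p1:
  fixes F :: "complex set"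
    and smul :: "complex \<Rightarrow> 'a::real_normed_algebra \<Rightarrow> 'a"
    and star :: "'a \<Rightarrow> 'a"
    and bs :: "block list"
    and \<phi> :: "'a \<Rightarrow> nat \<Rightarrow> qmat"
  assumes "fin_dim_cstar_algebra F smul star"
    and "matrix_block_decomposition F smul star bs \<phi>"
  shows "((\<forall>a b::'a. a * b = b * a) \<longleftrightarrow>
            UNIV = biorth_left_symmetrics F smul \<and>
            \<not> has_quaternionic_block bs) \<and>
         ((\<forall>a b::'a. a * b = b * a) \<longleftrightarrow>
            UNIV = biorth_left_symmetrics F smul \<and>
            (\<forall>As. minimal_FL_tuple F smul bs \<phi> As \<longrightarrow>
               \<not> (\<exists>p<length As. \<exists>q<length As. \<exists>r<length As. p \<noteq> q \<and> p \<noteq> r \<and> q \<noteq> r \<and>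
                    (\<exists>X. X \<noteq> 0 \<and> left_symmetric F smul X \<and>
                       property_FL F smul (out_except F smul As X p) \<and>
                       property_FL F smul (out_except F smul As X q) \<and>
                       property_FL F smul (out_except F smul As X r)))))"
proof -
  interpret matrix_blocks F smul star bs \<phi>
    using assms by (simp add: matrix_blocks_def matrix_blocks_axioms_def)
  have size_one_iff: "UNIV = biorth_left_symmetrics F smul \<longleftrightarrow> (\<forall>k<length bs. fst (bs ! k) = 1)"
  proof
    assume "\<forall>k<length bs. fst (bs ! k) = 1"
    then interpret size_one_blocks F smul star bs \<phi> by unfold_locales blast
    show "UNIV = biorth_left_symmetrics F smul" by (simp add: biorth_left_symmetrics_eq_UNIV)
  qed (use biorth_left_symmetrics_imp_size_one in blast)
  have quat_iff: "has_quaternionic_block bs \<longleftrightarrow> (\<exists>k<length bs. snd (bs ! k) = Quaternion_Div)"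
    unfolding has_quaternionic_block_def by (metis in_set_conv_nth)
  have no_quat_iff: "\<not> has_quaternionic_block bs \<longleftrightarrow>
      (\<forall>As. minimal_FL_tuple F smul bs \<phi> As \<longrightarrow>
         \<not> (\<exists>p<length As. \<exists>q<length As. \<exists>r<length As. p \<noteq> q \<and> p \<noteq> r \<and> q \<noteq> r \<and>
              (\<exists>X. X \<noteq> 0 \<and> left_symmetric F smul X \<and>
                 property_FL F smul (out_except F smul As X p) \<and>
                 property_FL F smul (out_except F smul As X q) \<and>
                 property_FL F smul (out_except F smul As X r))))"
    (is "_ \<longleftrightarrow> ?no_exchange") if "\<forall>k<length bs. fst (bs ! k) = 1"
  proof -
    interpret size_one_blocks F smul star bs \<phi> using that by unfold_locales blast
    show ?thesis
    proof (cases "F = UNIV")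
      case True
      have "\<not> has_quaternionic_block bs"
        using snd_block_complex [OF True] by (auto simp: quat_iff)
      moreover have ?no_exchange
        using minimal_FL_tuple_complex [OF True] by fastforce
      ultimately show ?thesis by blast
    next
      case False
      then interpret real_size_one_blocks F smul star bs \<phi>
        using field_real_or_complex by unfold_locales blast
      show ?thesis
      proof
        assume "\<not> has_quaternionic_block bs"
        then have "\<forall>k<length bs. snd (bs ! k) \<noteq> Quaternion_Div" by (auto simp: quat_iff)
        then show ?no_exchange
          using no_exchange_without_quaternions by blast
      next
        assume no_exchange: ?no_exchange
        show "\<not> has_quaternionic_block bs"
        proof
          assume "has_quaternionic_block bs"
          then obtain m where "m < length bs" "snd (bs ! m) = Quaternion_Div"
            by (auto simp: quat_iff)
          then obtain As p q r X where ex: "minimal_FL_tuple F smul bs \<phi> As"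
            "p < length As" "q < length As" "r < length As" "p \<noteq> q" "p \<noteq> r" "q \<noteq> r"
            "X \<noteq> 0" "left_symmetric F smul X"
            "property_FL F smul (out_except F smul As X p)"
            "property_FL F smul (out_except F smul As X q)"
            "property_FL F smul (out_except F smul As X r)"
            by (rule exchange_with_quaternions)
          show False
            using no_exchange [rule_format, OF ex(1)] ex(2-) by blast
        qed
      qed
    qed
  qed
  have abelian: "(\<forall>a b::'a. a * b = b * a) \<longleftrightarrow>
      UNIV = biorth_left_symmetrics F smul \<and> \<not> has_quaternionic_block bs"
    unfolding abelian_iff size_one_iff quat_iff by blast
  show ?thesis
    using abelian trans [OF abelian conj_cong [OF refl no_quat_iff [OF iffD1 [OF size_one_iff]]]]
    by (rule conjI)
qed

end
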